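(* Let $(A,\mathfrak m)$ be a Noetherian local ring of dimension one, $\hat A$ its completion, $B=A[Y]/I$, $Y=(Y_1,\ldots,Y_n)$, an $A$-algebra of finite type, and $c,\rho\in\mathbb N$. Let $(0)=\bigcap_{\mathfrak p\in\operatorname{Ass}A}Q_{\mathfrak p}$ be a reduced primary decomposition of $(0)$ in $A$, with $\sqrt{Q_{\mathfrak p}}=\mathfrak p$, and let $e\in\mathbb N$ be such that $\mathfrak p^e\subset Q_{\mathfrak p}$ for all $\mathfrak p\in\operatorname{Ass}A$. Suppose that there exists an $A$-morphism $v:B\to A/\mathfrak m^{(e+1)(\rho+1)+c}$ such that $$\bigl(v(((f):I)\Delta_f)\bigr)\supset \mathfrak m^{\rho}/\mathfrak m^{(e+1)(\rho+1)+c}$$ for some system $f=(f_1,\ldots,f_r)$, $r\le n$, of polynomials in $I$. Then there exists an $A$-morphism $v':B\to\hat A$ such that $v'\equiv v$ modulo $\mathfrak m^c$, that is, $v'(Y+I)\equiv v(Y+I)$ modulo $\mathfrak m^c$.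
   Context: For a system $f=(f_1,\ldots,f_r)$, $r\le n$, of polynomials from $I\subset A[Y]$, $\Delta_f$ denotes the ideal of $A[Y]$ generated by all $r\times r$-minors of the Jacobian matrix $(\partial f_i/\partial Y_j)$, and $((f):I)=\{g\in A[Y]: gI\subset (f)\}$, where $(f)$ is the ideal generated by $f_1,\ldots,f_r$. The expression $(v(((f):I)\Delta_f))$ denotes the ideal of $A/\mathfrak m^{(e+1)(\rho+1)+c}$ generated by the image under $v$ of (the class in $B$ of) the ideal $((f):I)\Delta_f$. The congruence $v'\equiv v$ modulo $\mathfrak m^c$ means that, for each $i$, the images of $v'(Y_i+I)$ and $v(Y_i+I)$ in $\hat A/\mathfrak m^c\hat A=A/\mathfrak m^c$ coincide. *)

theory Defs
  imports
    "HOL-Algebra.Algebra"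
    "HOL-Algebra.Algebraic_Closure_Type"
    "HOL-Library.Poly_Mapping"
    "HOL-Library.Extended_Nat"
    "Jordan_Normal_Form.Determinant"
begin

section \<open>Ideals\<close>

text \<open>Powers are taken in the monoid of ideals, so \<open>I\<close> to the power \<open>0\<close> is the whole ring.\<close>

abbreviation ideal_power :: "('a, 'b) ring_scheme \<Rightarrow> 'a set \<Rightarrow> nat \<Rightarrow> 'a set" where
  "ideal_power R I k \<equiv> I [^]\<^bsub>ideals_set R\<^esub> k"

definition ideal_radical :: "('a, 'b) ring_scheme \<Rightarrow> 'a set \<Rightarrow> 'a set" where
  "ideal_radical R I = {a \<in> carrier R. \<exists>k::nat. a [^]\<^bsub>R\<^esub> k \<in> I}"

definition ideal_quotient :: "('a, 'b) ring_scheme \<Rightarrow> 'a set \<Rightarrow> 'a set \<Rightarrow> 'a set" where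
  "ideal_quotient R J I = {g \<in> carrier R. \<forall>h\<in>I. g \<otimes>\<^bsub>R\<^esub> h \<in> J}"

definition primary_ideal :: "'a set \<Rightarrow> ('a, 'b) ring_scheme \<Rightarrow> bool" where
  "primary_ideal Q R \<longleftrightarrow> ideal Q R \<and> Q \<noteq> carrier R \<and>
     (\<forall>a\<in>carrier R. \<forall>b\<in>carrier R. a \<otimes>\<^bsub>R\<^esub> b \<in> Q \<longrightarrow> a \<in> Q \<or> b \<in> ideal_radical R Q)"

definition Ass :: "('a, 'b) ring_scheme \<Rightarrow> 'a set set" where
  "Ass R = {p. primeideal p R \<and>
     (\<exists>x\<in>carrier R. p = {a \<in> carrier R. a \<otimes>\<^bsub>R\<^esub> x = \<zero>\<^bsub>R\<^esub>})}"

text \<open>The components are indexed by their radicals, which are therefore pairwise distinct.\<close>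

definition reduced_primary_decomposition ::
    "('a, 'b) ring_scheme \<Rightarrow> 'a set \<Rightarrow> 'a set set \<Rightarrow> ('a set \<Rightarrow> 'a set) \<Rightarrow> bool" where
  "reduced_primary_decomposition R I S Q \<longleftrightarrow> finite S \<and>
     (\<forall>p\<in>S. primary_ideal (Q p) R \<and> ideal_radical R (Q p) = p) \<and>
     carrier R \<inter> (\<Inter>p\<in>S. Q p) = I \<and>
     (\<forall>p\<in>S. \<not> carrier R \<inter> (\<Inter>q\<in>S - {p}. Q q) \<subseteq> Q p)"


section \<open>Local rings, dimension, completion\<close>

definition local_ring :: "('a, 'b) ring_scheme \<Rightarrow> 'a set \<Rightarrow> bool" where
  "local_ring R m \<longleftrightarrow> cring R \<and> maximalideal m R \<and> (\<forall>J. maximalideal J R \<longrightarrow> J = m)"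

definition krull_dim :: "('a, 'b) ring_scheme \<Rightarrow> enat" where
  "krull_dim R = Sup {enat k |k. \<exists>P. (\<forall>i\<le>k. primeideal (P i) R) \<and> (\<forall>i<k. P i \<subset> P (Suc i))}"

text \<open>The map \<open>R/I \<rightarrow> S/J\<close> induced by a ring homomorphism \<open>h: R \<rightarrow> S\<close> with \<open>h(I) \<subseteq> J\<close>:
  it sends the coset \<open>I + a\<close> to \<open>J + h(I + a) = J + h(a)\<close>.\<close>

definition induced_map :: "('b, 'c) ring_scheme \<Rightarrow> 'b set \<Rightarrow> ('a \<Rightarrow> 'b) \<Rightarrow> 'a set \<Rightarrow> 'b set" where
  "induced_map S J h U = J <+>\<^bsub>S\<^esub> (h ` U)"

text \<open>The inverse limit of the rings \<open>R/m\<^sup>k\<close> along the canonical projections.\<close>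

definition completion :: "('a, 'b) ring_scheme \<Rightarrow> 'a set \<Rightarrow> (nat \<Rightarrow> 'a set) ring" where
  "completion R m = \<lparr>
     carrier = {x. (\<forall>k. x k \<in> carrier (R Quot ideal_power R m k)) \<and>
                   (\<forall>k. x k = induced_map R (ideal_power R m k) (\<lambda>a. a) (x (Suc k)))},
     monoid.mult = (\<lambda>x y k. x k \<otimes>\<^bsub>R Quot ideal_power R m k\<^esub> y k),
     one = (\<lambda>k. \<one>\<^bsub>R Quot ideal_power R m k\<^esub>),
     ring.zero = (\<lambda>k. \<zero>\<^bsub>R Quot ideal_power R m k\<^esub>),
     add = (\<lambda>x y k. x k \<oplus>\<^bsub>R Quot ideal_power R m k\<^esub> y k)\<rparr>"

definition completion_map :: "('a, 'b) ring_scheme \<Rightarrow> 'a set \<Rightarrow> 'a \<Rightarrow> nat \<Rightarrow> 'a set" where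
  "completion_map R m a = (\<lambda>k. ideal_power R m k +>\<^bsub>R\<^esub> a)"


section \<open>Algebra morphisms\<close>

text \<open>An \<open>R\<close>-algebra is a ring together with its structure map from \<open>R\<close>.\<close>

definition alg_hom ::
    "('a, 'r) ring_scheme \<Rightarrow> ('b, 's) ring_scheme \<Rightarrow> ('a \<Rightarrow> 'b) \<Rightarrow>
     ('c, 't) ring_scheme \<Rightarrow> ('a \<Rightarrow> 'c) \<Rightarrow> ('b \<Rightarrow> 'c) set" where
  "alg_hom R B \<phi> C \<psi> = {h \<in> Ring.ring_hom B C. \<forall>a\<in>carrier R. h (\<phi> a) = \<psi> a}"


section \<open>Polynomials in finitely many variables\<close>

text \<open>Monomials are finitely supported exponent functions. The \<open>n\<close> variables
  have the indices \<open>0, \<dots>, n - 1\<close>.\<close>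

type_synonym 'a mpoly = "(nat \<Rightarrow>\<^sub>0 nat) \<Rightarrow>\<^sub>0 'a"

definition mpoly_ring :: "nat \<Rightarrow> 'a::comm_ring_1 mpoly ring" where
  "mpoly_ring n =
     ring_of_type_algebra\<lparr>carrier := {p. \<forall>t\<in>Poly_Mapping.keys p. Poly_Mapping.keys t \<subseteq> {..<n}}\<rparr>"

definition mpoly_const :: "'a::comm_ring_1 \<Rightarrow> 'a mpoly" where
  "mpoly_const a = Poly_Mapping.single 0 a"

definition mpoly_var :: "nat \<Rightarrow> 'a::comm_ring_1 mpoly" where
  "mpoly_var i = Poly_Mapping.single (Poly_Mapping.single i 1) 1"

text \<open>If the variable \<open>i\<close> does not occur in the monomial \<open>t\<close>, then the truncated subtraction
  is harmless, since the coefficient is zero.\<close>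

definition mpoly_deriv :: "nat \<Rightarrow> 'a::comm_ring_1 mpoly \<Rightarrow> 'a mpoly" where
  "mpoly_deriv i p = (\<Sum>t\<in>Poly_Mapping.keys p.
     Poly_Mapping.single (t - Poly_Mapping.single i 1)
       (of_nat (Poly_Mapping.lookup t i) * Poly_Mapping.lookup p t))"

text \<open>The minor of the Jacobian matrix of \<open>f 0, \<dots>, f (r - 1)\<close> given by the columns
  \<open>s 0 < \<dots> < s (r - 1)\<close>. For \<open>r = 0\<close> the only minor is \<open>1\<close>.\<close>

definition jacobian_minor :: "nat \<Rightarrow> (nat \<Rightarrow> 'a::comm_ring_1 mpoly) \<Rightarrow> (nat \<Rightarrow> nat) \<Rightarrow> 'a mpoly" where
  "jacobian_minor r f s = det (mat r r (\<lambda>(i, j). mpoly_deriv (s j) (f i)))"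

definition jacobian_ideal :: "nat \<Rightarrow> nat \<Rightarrow> (nat \<Rightarrow> 'a::comm_ring_1 mpoly) \<Rightarrow> 'a mpoly set" where
  "jacobian_ideal n r f = genideal (mpoly_ring n)
     {jacobian_minor r f s |s. strict_mono_on {..<r} s \<and> s ` {..<r} \<subseteq> {..<n}}"

end

theory Submission
  imports Defs
begin

text \<open>
  Almost everything happens in \<open>A\<close> itself; the completion enters only as a place where a
  sequence converges. Let \<open>y \<in> A\<^sup>n\<close> lift \<open>v(Y\<^sub>1), \<dots>, v(Y\<^sub>n)\<close>, so that \<open>g(y) \<in> \<mm>\<^sup>N\<close> for
  every \<open>g \<in> I\<close>, and put \<open>H = ((f) : I) \<Delta>\<^sub>f\<close>. The values \<open>H(y) = {h(y) | h \<in> H}\<close> form an ideal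
  of \<open>A\<close>, and the hypothesis on \<open>v\<close> gives \<open>\<mm>\<^sup>\<rho> \<subseteq> H(y) + \<mm>\<^bsup>\<rho> + 1\<^esup>\<close>. This inclusion does not change
  when \<open>y\<close> moves modulo \<open>\<mm>\<^bsup>\<rho> + 1\<^esup>\<close>.

  Newton iteration for \<open>f\<close>. By Cramer's rule, for every \<open>d \<in> \<Delta>\<^sub>f\<close> and every vector \<open>w\<close> with entries
  in an ideal \<open>S\<close>, the system \<open>J z = d(y) w\<close>, where \<open>J\<close> is the Jacobian matrix at \<open>y\<close>, has a
  solution \<open>z\<close> with entries in \<open>S\<close> (\<open>jacobian_ideal_solves\<close>). If \<open>f(y) \<in> \<mm>\<^sup>K\<close>, we split
  \<open>\<mm>\<^sup>K = \<mm>\<^sup>\<rho> \<mm>\<^bsup>K - \<rho>\<^esup>\<close> and replace the factor \<open>\<mm>\<^sup>\<rho>\<close> by values of \<open>H \<subseteq> \<Delta>\<^sub>f\<close>: there is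
  \<open>z \<in> \<mm>\<^bsup>K - \<rho>\<^esup>\<close> with \<open>f(y) + J z \<in> \<mm>\<^bsup>K + 1\<^esup>\<close>. The Taylor remainder lies in \<open>\<mm>\<^bsup>2(K - \<rho>)\<^esup>\<close>, which is
  contained in \<open>\<mm>\<^bsup>K + 1\<^esup>\<close> because \<open>K \<ge> 2\<rho> + 1\<close>; for \<open>K \<ge> N\<close> this follows from \<open>e \<ge> 1\<close>.
  So \<open>f(y + z) \<in> \<mm>\<^bsup>K + 1\<^esup>\<close> (\<open>newton_step\<close>), and
  iterating gives a Cauchy sequence \<open>y\<^sub>k \<equiv> y\<close> modulo \<open>\<mm>\<^bsup>N - \<rho>\<^esup>\<close> with \<open>f(y\<^sub>k) \<in> \<mm>\<^bsup>N + k\<^esup>\<close>.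

  From \<open>f\<close> to \<open>I\<close>. Since \<open>H I \<subseteq> (f)\<close>, the values \<open>g(y\<^sub>k)\<close> of \<open>g \<in> I\<close> satisfy
  \<open>\<mm>\<^sup>\<rho> g(y\<^sub>k) \<subseteq> \<mm>\<^bsup>N + k\<^esup>\<close> (\<open>values_annihilated\<close>), and they lie in \<open>\<mm>\<^sup>e\<close> because \<open>y\<^sub>k\<close> is close to \<open>y\<close>.
  They tend to \<open>0\<close> because of \<open>pw_colon_pw_subset\<close>: an element of \<open>\<mm>\<^sup>e\<close> which \<open>\<mm>\<^sup>\<rho>\<close> multiplies into a
  high power of \<open>\<mm>\<close> is itself in a high power. This is where the dimension and the primary
  decomposition matter. Prime avoidance gives \<open>s \<in> \<mm>\<close> outside all associated primes other than
  \<open>\<mm>\<close>. In dimension one \<open>\<mm>\<close> is then the only prime ideal containing \<open>s\<close>, so \<open>\<mm>\<^sup>q \<subseteq> s A\<close> for some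
  \<open>q\<close>. If \<open>s\<^sup>\<rho> a\<close> lies in \<open>\<mm>\<^bsup>K q\<^esup> \<subseteq> s\<^sup>K A\<close>, say \<open>s\<^sup>\<rho> a = s\<^sup>K w\<close>, then \<open>d = a - s\<^bsup>K - \<rho>\<^esup> w\<close> is killed by
  \<open>s\<^sup>\<rho>\<close> and hence lies in every component \<open>Q\<^sub>\<pp>\<close> with \<open>\<pp> \<noteq> \<mm>\<close>; for \<open>K \<ge> \<rho> + e\<close> it
  also lies in \<open>\<mm>\<^sup>e\<close>, hence in \<open>Q\<^sub>\<mm>\<close> if \<open>\<mm>\<close> is associated. So \<open>d = 0\<close> and \<open>a \<in> \<mm>\<^bsup>K - \<rho>\<^esup>\<close>.

  The morphism \<open>v'\<close> sends the class of \<open>p\<close> to the limit of \<open>p(y\<^sub>k)\<close>. It is congruent to \<open>v\<close> modulo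
  \<open>\<mm>\<^sup>c\<close> because \<open>N - \<rho> \<ge> c\<close> and because a limit of elements of the finitely generated ideal \<open>\<mm>\<^sup>c\<close>
  lies in its extension to the completion (\<open>adic_limit_mem_extended_pw\<close>).
\<close>

section \<open>Ideals and their powers in a commutative ring\<close>

abbreviation type_ring :: "'a::comm_ring_1 ring" where
  "type_ring \<equiv> ring_of_type_algebra"

lemma type_ring_simps [simp]:
  "carrier type_ring = UNIV" "x \<otimes>\<^bsub>type_ring\<^esub> y = x * y" "x \<oplus>\<^bsub>type_ring\<^esub> y = x + y"
  "\<zero>\<^bsub>type_ring\<^esub> = 0" "\<one>\<^bsub>type_ring\<^esub> = 1"
  by (simp_all add: ring_of_type_algebra_def)

lemma type_ring_cring: "cring (type_ring :: 'a::comm_ring_1 ring)"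
  by (rule cring_from_type_algebra)

lemma type_ring_ring: "ring (type_ring :: 'a::comm_ring_1 ring)"
  by (rule ring_from_type_algebra)

lemma type_ring_uminus [simp]: "\<ominus>\<^bsub>type_ring\<^esub> (x :: 'a::comm_ring_1) = - x"
proof -
  interpret ring "type_ring :: 'a ring" by (rule type_ring_ring)
  show ?thesis using minus_equality[of "- x" x] by simp
qed

lemma type_ring_pow [simp]: "x [^]\<^bsub>type_ring\<^esub> (k::nat) = x ^ k"
  by (induction k) (simp_all add: mult.commute)

text \<open>Closure under multiplication by \<open>-1\<close> provides the negatives that an additive subgroup needs.\<close>

lemma ideal_type_ring_iff:
  "ideal S (type_ring :: 'a::comm_ring_1 ring) \<longleftrightarrow>
     0 \<in> S \<and> (\<forall>x\<in>S. \<forall>y\<in>S. x + y \<in> S) \<and> (\<forall>a. \<forall>x\<in>S. a * x \<in> S)" (is "_ \<longleftrightarrow> ?R")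
proof
  assume "ideal S type_ring"
  then interpret ideal S "type_ring :: 'a ring" .
  show ?R
    using additive_subgroup.zero_closed[OF is_additive_subgroup]
      additive_subgroup.a_closed[OF is_additive_subgroup] I_l_closed by simp
next
  assume R: ?R
  have "- x \<in> S" if "x \<in> S" for x
    using R that by (metis mult_minus1)
  then have "\<ominus>\<^bsub>type_ring\<^esub> x \<in> S" if "x \<in> S" for x
    using that by simp
  then have "subgroup S (add_monoid type_ring)"
    using R unfolding a_inv_def
    by (intro group.subgroupI abelian_group.a_group ring.is_abelian_group type_ring_ring) auto
  moreover have "x * a \<in> S" if "x \<in> S" for x a
    using R that by (metis mult.commute)
  ultimately show "ideal S type_ring"
    using R by (intro idealI type_ring_ring) auto
qed

context
  fixes S :: "'a::comm_ring_1 set"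
  assumes S: "ideal S type_ring"
begin

lemma ideal_0: "0 \<in> S"
  and ideal_add: "x \<in> S \<Longrightarrow> y \<in> S \<Longrightarrow> x + y \<in> S"
  and ideal_mult_left: "x \<in> S \<Longrightarrow> a * x \<in> S"
  using S by (auto simp: ideal_type_ring_iff)

lemma ideal_mult_right: "x \<in> S \<Longrightarrow> x * a \<in> S"
  using ideal_mult_left[of x a] by (simp add: mult.commute)

lemma ideal_uminus: "x \<in> S \<Longrightarrow> - x \<in> S"
  using ideal_mult_left[of x "-1"] by simp

lemma ideal_diff: "x \<in> S \<Longrightarrow> y \<in> S \<Longrightarrow> x - y \<in> S"
  using ideal_add[of x "- y"] ideal_uminus[of y] by simp

lemma ideal_sum: "(\<And>i. i \<in> T \<Longrightarrow> g i \<in> S) \<Longrightarrow> sum g T \<in> S"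
  by (induction T rule: infinite_finite_induct) (auto intro: ideal_add ideal_0)

lemma ideal_mem_cong: "x - y \<in> S \<Longrightarrow> x \<in> S \<longleftrightarrow> y \<in> S"
  using ideal_add[of "x - y" y] ideal_diff[of x "x - y"] by auto

lemma coset_eq: "S +>\<^bsub>type_ring\<^esub> a = {x. x - a \<in> S}"
proof -
  have "x \<in> S +>\<^bsub>type_ring\<^esub> a \<longleftrightarrow> x - a \<in> S" for x
    by (auto simp: a_r_coset_def' intro!: bexI[of _ "x - a"])
  then show ?thesis by blast
qed

lemma coset_eq_iff: "S +>\<^bsub>type_ring\<^esub> a = S +>\<^bsub>type_ring\<^esub> b \<longleftrightarrow> a - b \<in> S"
proof
  assume "S +>\<^bsub>type_ring\<^esub> a = S +>\<^bsub>type_ring\<^esub> b"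
  moreover have "a \<in> S +>\<^bsub>type_ring\<^esub> a" by (simp add: coset_eq ideal_0)
  ultimately show "a - b \<in> S" by (simp add: coset_eq)
next
  assume "a - b \<in> S"
  then have "x - a \<in> S \<longleftrightarrow> x - b \<in> S" for x
    using ideal_mem_cong[of "x - b" "x - a"] by (simp add: algebra_simps)
  then show "S +>\<^bsub>type_ring\<^esub> a = S +>\<^bsub>type_ring\<^esub> b" by (simp add: coset_eq)
qed

lemma carrier_type_Quot: "carrier (type_ring Quot S) = range (\<lambda>a. S +>\<^bsub>type_ring\<^esub> a)"
  by (auto simp: FactRing_def A_RCOSETS_def' a_r_coset_def')

lemma coset_mult:
  "(S +>\<^bsub>type_ring\<^esub> a) \<otimes>\<^bsub>type_ring Quot S\<^esub> (S +>\<^bsub>type_ring\<^esub> b) = S +>\<^bsub>type_ring\<^esub> (a * b)"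
  using ideal.rcoset_mult_add[OF S, of a b] by (simp add: FactRing_def)

lemma coset_add:
  "(S +>\<^bsub>type_ring\<^esub> a) \<oplus>\<^bsub>type_ring Quot S\<^esub> (S +>\<^bsub>type_ring\<^esub> b) = S +>\<^bsub>type_ring\<^esub> (a + b)"
  using ideal.a_rcos_sum[OF S, of a b] by (simp add: FactRing_def)

lemma coset_one: "\<one>\<^bsub>type_ring Quot S\<^esub> = S +>\<^bsub>type_ring\<^esub> 1"
  by (simp add: FactRing_def)

lemma coset_zero: "\<zero>\<^bsub>type_ring Quot S\<^esub> = S +>\<^bsub>type_ring\<^esub> 0"
  by (simp add: FactRing_def coset_eq)

end

locale ideal_adic =
  fixes \<mm> :: "'a::comm_ring_1 set"
  assumes ideal_m: "ideal \<mm> type_ring"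
begin

definition pw :: "nat \<Rightarrow> 'a set" where
  "pw k = ideal_power type_ring \<mm> k"

lemma pw_0: "pw 0 = UNIV"
  by (simp add: pw_def ideals_set_def)

lemma pw_Suc: "pw (Suc k) = ideal_prod type_ring (pw k) \<mm>"
  by (simp add: pw_def ideals_set_def)

lemma ideal_pw: "ideal (pw k) type_ring"
proof (induction k)
  case 0
  show ?case unfolding pw_0 by (simp add: ideal_type_ring_iff)
next
  case (Suc k)
  then show ?case unfolding pw_Suc
    by (intro ring.ideal_prod_is_ideal type_ring_ring ideal_m)
qed

lemmas pw_zero = ideal_0[OF ideal_pw]
  and pw_plus = ideal_add[OF ideal_pw]
  and pw_minus = ideal_diff[OF ideal_pw]
  and pw_uminus = ideal_uminus[OF ideal_pw]
  and pw_mult_left = ideal_mult_left[OF ideal_pw]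
  and pw_mult_right = ideal_mult_right[OF ideal_pw]
  and pw_sum = ideal_sum[OF ideal_pw]

lemma pw_Suc_subset: "pw (Suc k) \<subseteq> pw k"
proof
  fix x assume "x \<in> pw (Suc k)"
  then show "x \<in> pw k" unfolding pw_Suc
    by (induction rule: ideal_prod.induct) (auto intro: pw_plus pw_mult_right)
qed

lemma pw_antimono: "i \<le> j \<Longrightarrow> pw j \<subseteq> pw i"
  by (rule lift_Suc_antimono_le[of pw]) (use pw_Suc_subset in auto)

lemma pw_antimonoD: "x \<in> pw j \<Longrightarrow> i \<le> j \<Longrightarrow> x \<in> pw i"
  using pw_antimono by blast

lemma pw_add: "pw (i + j) = ideal_prod type_ring (pw i) (pw j)"
proof -
  interpret comm_monoid "ideals_set (type_ring :: 'a ring)"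
    by (rule cring.ideals_set_is_comm_monoid[OF type_ring_cring])
  have "\<mm> \<in> carrier (ideals_set type_ring)"
    by (simp add: ideals_set_def ideal_m)
  from nat_pow_mult[OF this, of i j] show ?thesis
    by (simp add: pw_def ideals_set_def)
qed

lemma pw_mult: "x \<in> pw i \<Longrightarrow> y \<in> pw j \<Longrightarrow> x * y \<in> pw (i + j)"
  unfolding pw_add using ideal_prod.prod[of x _ y _ type_ring] by simp

text \<open>The ideal \<open>\<mm>\<^bsup>i + j\<^esup>\<close> consists of sums of products. Several arguments below use this principle to
  split off a factor from \<open>\<mm>\<^sup>i\<close> and to work with it alone.\<close>

lemma pw_add_induct [consumes 1, case_names mult add]:
  assumes "x \<in> pw (i + j)"
    and "\<And>a b. a \<in> pw i \<Longrightarrow> b \<in> pw j \<Longrightarrow> P (a * b)"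
    and "\<And>a b. P a \<Longrightarrow> P b \<Longrightarrow> P (a + b)"
  shows "P x"
  using assms(1) unfolding pw_add
  by (induction rule: ideal_prod.induct) (auto intro: assms(2,3))

lemma pw_1: "pw (Suc 0) = \<mm>"
proof -
  interpret comm_monoid "ideals_set (type_ring :: 'a ring)"
    by (rule cring.ideals_set_is_comm_monoid[OF type_ring_cring])
  show ?thesis
    using nat_pow_eone[of \<mm>] by (simp add: pw_def ideals_set_def ideal_m)
qed

lemma power_in_pw: "x \<in> pw i \<Longrightarrow> x ^ k \<in> pw (k * i)"
  by (induction k) (auto simp: pw_0 intro: pw_mult)

end

section \<open>Prime ideals in a local ring of dimension at most one\<close>

lemma primeideal_type_ring_iff:
  "primeideal p (type_ring :: 'a::comm_ring_1 ring) \<longleftrightarrow>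
     ideal p type_ring \<and> p \<noteq> UNIV \<and> (\<forall>a b. a * b \<in> p \<longrightarrow> a \<in> p \<or> b \<in> p)" (is "_ \<longleftrightarrow> ?R")
proof
  assume p: "primeideal p type_ring"
  show ?R
    using primeideal.axioms(1)[OF p] primeideal.I_notcarr[OF p] primeideal.I_prime[OF p] by auto
next
  assume ?R
  then show "primeideal p type_ring"
    by (intro primeidealI type_ring_cring) auto
qed

context
  fixes p :: "'a::comm_ring_1 set"
  assumes p: "primeideal p type_ring"
begin

lemma prime_one: "1 \<notin> p"
  using p ideal_mult_left[of p 1] by (auto simp: primeideal_type_ring_iff)

lemma prime_multD: "a * b \<in> p \<Longrightarrow> a \<in> p \<or> b \<in> p"
  using p by (auto simp: primeideal_type_ring_iff)

lemma prime_prodD: "prod g T \<in> p \<Longrightarrow> \<exists>x\<in>T. g x \<in> p"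
proof (induction T rule: infinite_finite_induct)
  case (insert x T)
  then have "g x * prod g T \<in> p" by simp
  from prime_multD[OF this] insert.IH show ?case by blast
qed (use prime_one in simp_all)

lemma prime_powerD: "a ^ k \<in> p \<Longrightarrow> a \<in> p"
proof (induction k)
  case (Suc k)
  then have "a * a ^ k \<in> p" by simp
  from prime_multD[OF this] Suc.IH show ?case by blast
qed (use prime_one in simp)

end

text \<open>Induction on the number of primes. If one of them contains another, the smaller one is redundant.
  Otherwise choose \<open>s \<in> \<mm>\<close> outside all primes except possibly \<open>p\<close>. If \<open>s \<in> p\<close>, add to it an element
  of \<open>\<mm>\<close> which lies in all the other primes but not in \<open>p\<close>; a product of elements outside \<open>p\<close>
  provides one.\<close>

lemma prime_avoidance:
  assumes m: "ideal \<mm> (type_ring :: 'a::comm_ring_1 ring)" and S: "finite S"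
    and prime: "\<And>p. p \<in> S \<Longrightarrow> primeideal p type_ring" and not_sub: "\<And>p. p \<in> S \<Longrightarrow> \<not> \<mm> \<subseteq> p"
  shows "\<exists>s\<in>\<mm>. \<forall>p\<in>S. s \<notin> p"
  using S prime not_sub
proof (induction S rule: finite_psubset_induct)
  case (psubset S)
  have IH: "\<exists>s\<in>\<mm>. \<forall>p\<in>T. s \<notin> p" if "T \<subset> S" for T
  proof (rule psubset.IH[OF that])
    fix p assume "p \<in> T"
    then have "p \<in> S" using that by blast
    then show "primeideal p type_ring" "\<not> \<mm> \<subseteq> p" by (fact psubset.prems)+
  qed
  have ideal: "ideal p type_ring" if "p \<in> S" for p
    using psubset.prems(1)[OF that] by (rule primeideal.axioms(1))
  show ?case
  proof (cases "\<exists>p\<in>S. \<exists>q\<in>S. p \<noteq> q \<and> q \<subseteq> p")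
    case True
    then obtain p q where pq: "p \<in> S" "q \<in> S" "p \<noteq> q" "q \<subseteq> p" by blast
    then have "S - {q} \<subset> S" by blast
    from IH[OF this] obtain s where s: "s \<in> \<mm>" "\<forall>p\<in>S - {q}. s \<notin> p" by blast
    have "s \<notin> q" using s(2) pq by blast
    with s show ?thesis by blast
  next
    case False
    show ?thesis
    proof (cases "S = {}")
      case True
      then show ?thesis using ideal_0[OF m] by auto
    next
      case nonempty: False
      then obtain p where p: "p \<in> S" by blast
      then have "S - {p} \<subset> S" by blast
      from IH[OF this] obtain s where s: "s \<in> \<mm>" "\<And>q. q \<in> S - {p} \<Longrightarrow> s \<notin> q" by blast
      show ?thesis
      proof (cases "s \<in> p")
        case False
        with s show ?thesis by blast
      next
        case True
        obtain t0 where t0: "t0 \<in> \<mm>" "t0 \<notin> p" using psubset.prems(2)[OF p] by blast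
        have "\<forall>q\<in>S - {p}. \<exists>x. x \<in> q \<and> x \<notin> p"
          using False p by blast
        then obtain t where t: "\<And>q. q \<in> S - {p} \<Longrightarrow> t q \<in> q" "\<And>q. q \<in> S - {p} \<Longrightarrow> t q \<notin> p"
          by metis
        define u where "u = t0 * (\<Prod>q\<in>S - {p}. t q)"
        have u_m: "u \<in> \<mm>" unfolding u_def by (rule ideal_mult_right[OF m t0(1)])
        have u_p: "u \<notin> p"
        proof
          assume "u \<in> p"
          then have "(\<Prod>q\<in>S - {p}. t q) \<in> p"
            using prime_multD[OF psubset.prems(1)[OF p]] t0(2) unfolding u_def by blast
          then obtain q where "q \<in> S - {p}" "t q \<in> p"
            using prime_prodD[OF psubset.prems(1)[OF p]] by blast
          with t(2) show False by blast
        qed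
        have u_q: "u \<in> q" if q: "q \<in> S - {p}" for q
        proof -
          have q_ideal: "ideal q type_ring" using q by (intro ideal) simp
          have "(\<Prod>q\<in>S - {p}. t q) = t q * (\<Prod>q\<in>S - {p} - {q}. t q)"
            using q psubset.hyps by (intro prod.remove) auto
          moreover have "t q * (\<Prod>q\<in>S - {p} - {q}. t q) \<in> q"
            by (rule ideal_mult_right[OF q_ideal t(1)[OF q]])
          ultimately show ?thesis
            unfolding u_def by (intro ideal_mult_left[OF q_ideal]) simp
        qed
        have "s + u \<notin> q" if q: "q \<in> S" for q
        proof
          assume su: "s + u \<in> q"
          show False
          proof (cases "q = p")
            case qp: True
            from ideal_diff[OF ideal[OF q] su, of s] have "u \<in> p"
              using True unfolding qp by simp
            with u_p show False by blast
          next
            case False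
            with q have q': "q \<in> S - {p}" by simp
            from ideal_diff[OF ideal[OF q] su u_q[OF q']] have "s \<in> q" by simp
            with s(2)[OF q'] show False by blast
          qed
        qed
        then show ?thesis using ideal_add[OF m s(1) u_m] by blast
      qed
    qed
  qed
qed

lemma noetherian_maximal:
  assumes noeth: "noetherian_ring (type_ring :: 'a::comm_ring_1 ring)"
    and \<F>: "\<F> \<subseteq> {J. ideal J (type_ring :: 'a ring)}" "\<F> \<noteq> {}"
  obtains J where "J \<in> \<F>" "\<And>J'. J' \<in> \<F> \<Longrightarrow> J \<subseteq> J' \<Longrightarrow> J' = J"
proof -
  have "\<Union>C \<in> \<F>" if "C \<noteq> {}" "subset.chain \<F> C" for C
  proof -
    have "subset.chain {J. ideal J (type_ring :: 'a ring)} C"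
      using that(2) \<F>(1) unfolding subset.chain_def by blast
    from noetherian_ring.ideal_chain_is_trivial[OF noeth that(1) this]
    show ?thesis using that(2) unfolding subset.chain_def by blast
  qed
  from subset_Zorn_nonempty[OF \<F>(2) this] show ?thesis
    using that by blast
qed

lemma principal_ideal_type_ring: "ideal (range ((*) s)) (type_ring :: 'a::comm_ring_1 ring)"
  unfolding ideal_type_ring_iff
proof (intro conjI ballI allI)
  show "0 \<in> range ((*) s)" by (intro range_eqI[of _ _ 0]) simp
next
  fix x y assume "x \<in> range ((*) s)" "y \<in> range ((*) s)"
  then show "x + y \<in> range ((*) s)" by (auto simp: distrib_left[symmetric])
next
  fix a x assume "x \<in> range ((*) s)"
  then show "a * x \<in> range ((*) s)" by (auto simp: mult.left_commute[of a])
qed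

lemma ideal_adjoin:
  assumes "ideal J (type_ring :: 'a::comm_ring_1 ring)"
  shows "ideal {x + a * r | x r. x \<in> J} type_ring"
  unfolding ideal_type_ring_iff
proof (intro conjI ballI allI)
  show "0 \<in> {x + a * r | x r. x \<in> J}"
    using ideal_0[OF assms] by (intro CollectI exI[of _ 0]) auto
next
  fix y y' assume "y \<in> {x + a * r | x r. x \<in> J}" "y' \<in> {x + a * r | x r. x \<in> J}"
  then obtain x r x' r' where "y = x + a * r" "y' = x' + a * r'" "x \<in> J" "x' \<in> J" by blast
  then show "y + y' \<in> {x + a * r | x r. x \<in> J}"
    using ideal_add[OF assms, of x x']
    by (intro CollectI exI[of _ "x + x'"] exI[of _ "r + r'"]) (auto simp: algebra_simps)
next
  fix b y assume "y \<in> {x + a * r | x r. x \<in> J}"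
  then obtain x r where "y = x + a * r" "x \<in> J" by blast
  then show "b * y \<in> {x + a * r | x r. x \<in> J}"
    using ideal_mult_left[OF assms, of x b]
    by (intro CollectI exI[of _ "b * x"] exI[of _ "b * r"]) (auto simp: algebra_simps)
qed

context ideal_adic
begin

text \<open>An ideal which is maximal among those that contain \<open>s\<close> but no power of \<open>\<mm>\<close> is prime: if \<open>a\<close> and
  \<open>b\<close> are outside \<open>J\<close>, then \<open>J + (a)\<close> and \<open>J + (b)\<close> contain powers of \<open>\<mm>\<close>, hence so does
  their product, which is contained in \<open>J + (ab)\<close>. Such a prime ideal would be \<open>\<mm>\<close>, which contains
  \<open>\<mm>\<^sup>1\<close>. So no such ideal exists, and \<open>(s)\<close> contains a power of \<open>\<mm>\<close>.\<close>

lemma pw_subset_principal: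
  assumes noeth: "noetherian_ring (type_ring :: 'a ring)"
    and only: "\<And>p. primeideal p type_ring \<Longrightarrow> s \<in> p \<Longrightarrow> p = \<mm>"
  shows "\<exists>q. pw q \<subseteq> range ((*) s)"
proof (rule ccontr)
  assume neg: "\<nexists>q. pw q \<subseteq> range ((*) s)"
  define \<F> where "\<F> = {J. ideal J (type_ring :: 'a ring) \<and> s \<in> J \<and> (\<forall>q. \<not> pw q \<subseteq> J)}"
  have "s \<in> range ((*) s)" by (intro range_eqI[of _ _ 1]) simp
  then have "range ((*) s) \<in> \<F>"
    using neg by (auto simp: \<F>_def principal_ideal_type_ring)
  then obtain J where J: "J \<in> \<F>" and max: "\<And>J'. J' \<in> \<F> \<Longrightarrow> J \<subseteq> J' \<Longrightarrow> J' = J"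
    using noetherian_maximal[OF noeth, of \<F>] unfolding \<F>_def by blast
  have J_ideal: "ideal J type_ring" and sJ: "s \<in> J" and J_pw: "\<And>q. \<not> pw q \<subseteq> J"
    using J by (auto simp: \<F>_def)
  have adjoin: "\<exists>q. pw q \<subseteq> {x + a * r | x r. x \<in> J}" if "a \<notin> J" for a
  proof (rule ccontr)
    assume "\<nexists>q. pw q \<subseteq> {x + a * r | x r. x \<in> J}"
    moreover have sub: "J \<subseteq> {x + a * r | x r. x \<in> J}"
    proof
      fix x assume "x \<in> J"
      moreover have "x = x + a * 0" by simp
      ultimately show "x \<in> {x + a * r | x r. x \<in> J}" by blast
    qed
    ultimately have "{x + a * r | x r. x \<in> J} \<in> \<F>"
      using ideal_adjoin[OF J_ideal] sJ unfolding \<F>_def by blast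
    then have "{x + a * r | x r. x \<in> J} = J" using sub by (rule max)
    moreover have "a \<in> {x + a * r | x r. x \<in> J}"
      using ideal_0[OF J_ideal] by (intro CollectI exI[of _ 0] exI[of _ 1]) auto
    ultimately show False using that by simp
  qed
  have "primeideal J type_ring"
    unfolding primeideal_type_ring_iff
  proof (intro conjI allI impI J_ideal)
    show "J \<noteq> UNIV" using J_pw[of 0] by auto
  next
    fix a b assume ab: "a * b \<in> J"
    show "a \<in> J \<or> b \<in> J"
    proof (rule ccontr)
      assume "\<not> (a \<in> J \<or> b \<in> J)"
      then obtain i j where ij: "pw i \<subseteq> {x + a * r | x r. x \<in> J}" "pw j \<subseteq> {x + b * r | x r. x \<in> J}"
        using adjoin by meson
      have "x \<in> J" if "x \<in> pw (i + j)" for x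
        using that
      proof (induction rule: pw_add_induct)
        case (mult c d)
        with ij obtain x r x' r' where "c = x + a * r" "d = x' + b * r'" "x \<in> J" "x' \<in> J"
          by blast
        then have "c * d = d * x + (a * r) * x' + r * r' * (a * b)" by (simp add: algebra_simps)
        then show ?case
          using ab \<open>x \<in> J\<close> \<open>x' \<in> J\<close>
          by (auto intro!: ideal_add[OF J_ideal] ideal_mult_left[OF J_ideal])
      next
        case (add x y)
        then show ?case by (rule ideal_add[OF J_ideal])
      qed
      then show False using J_pw[of "i + j"] by blast
    qed
  qed
  then have "J = \<mm>" using sJ by (rule only)
  then show False using J_pw[of "Suc 0"] by (simp add: pw_1)
qed

end

lemma local_ring_proper_subset:
  assumes noeth: "noetherian_ring (type_ring :: 'a::comm_ring_1 ring)"
    and local: "local_ring type_ring \<mm>" and J: "ideal J (type_ring :: 'a ring)" "J \<noteq> UNIV"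
  shows "J \<subseteq> \<mm>"
proof -
  define \<F> where "\<F> = {J'. ideal J' (type_ring :: 'a ring) \<and> J \<subseteq> J' \<and> J' \<noteq> UNIV}"
  have "J \<in> \<F>" using J by (simp add: \<F>_def)
  then obtain M where M: "M \<in> \<F>" and max: "\<And>J'. J' \<in> \<F> \<Longrightarrow> M \<subseteq> J' \<Longrightarrow> J' = M"
    using noetherian_maximal[OF noeth, of \<F>] unfolding \<F>_def by blast
  have "maximalideal M type_ring"
    using M max by (intro maximalidealI) (auto simp: \<F>_def)
  then show ?thesis
    using local M by (auto simp: local_ring_def \<F>_def)
qed

lemma no_prime_chain_if_dim_le_1:
  assumes "krull_dim R \<le> 1" "primeideal p R" "primeideal q R" "primeideal m R" "p \<subset> q" "q \<subset> m"
  shows False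
proof -
  let ?P = "\<lambda>i::nat. if i = 0 then p else if i = 1 then q else m"
  have "(\<forall>i\<le>2. primeideal (?P i) R) \<and> (\<forall>i<2. ?P i \<subset> ?P (Suc i))"
    using assms by (auto simp: less_2_cases_iff)
  then have "\<exists>P. (\<forall>i\<le>2. primeideal (P i) R) \<and> (\<forall>i<2. P i \<subset> P (Suc i))"
    by (rule exI[of _ ?P])
  then have "enat 2 \<le> krull_dim R"
    unfolding krull_dim_def by (intro Sup_upper CollectI exI[of _ 2] conjI refl)
  then have "enat 2 \<le> enat 1" using assms(1) by (metis one_enat_def order.trans)
  then show False by simp
qed

text \<open>Otherwise every \<open>p \<in> S\<close> has an element \<open>x\<^sub>p \<notin> P\<close> with some power in \<open>Q\<^sub>p\<close>. The product of these
  powers lies in all components, so it is \<open>0 \<in> P\<close>, although none of its factors is in \<open>P\<close>.\<close>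

lemma prime_contains_component:
  assumes Q: "reduced_primary_decomposition (type_ring :: 'a::comm_ring_1 ring) {0} S Q"
    and P: "primeideal P type_ring"
  shows "\<exists>p\<in>S. p \<subseteq> P"
proof (rule ccontr)
  assume "\<not> (\<exists>p\<in>S. p \<subseteq> P)"
  then have "\<exists>x. \<forall>p. p \<in> S \<longrightarrow> x p \<in> p \<and> x p \<notin> P"
    by (intro choice) blast
  then obtain x where x: "\<And>p. p \<in> S \<Longrightarrow> x p \<in> p" "\<And>p. p \<in> S \<Longrightarrow> x p \<notin> P" by blast
  have fin: "finite S" and ideal: "\<And>p. p \<in> S \<Longrightarrow> ideal (Q p) type_ring"
    and rad: "\<And>p. p \<in> S \<Longrightarrow> ideal_radical type_ring (Q p) = p"
    and zero: "(\<Inter>p\<in>S. Q p) = {0}"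
    using Q by (auto simp: reduced_primary_decomposition_def primary_ideal_def)
  have "\<exists>k. \<forall>p. p \<in> S \<longrightarrow> x p ^ (k p :: nat) \<in> Q p"
    using x(1) rad by (intro choice) (fastforce simp: ideal_radical_def)
  then obtain k :: "'a set \<Rightarrow> nat" where k: "\<And>p. p \<in> S \<Longrightarrow> x p ^ k p \<in> Q p" by blast
  have "(\<Prod>p\<in>S. x p ^ k p) \<in> Q q" if "q \<in> S" for q
    unfolding prod.remove[OF fin that] by (intro ideal_mult_right ideal k that)
  then have "(\<Prod>p\<in>S. x p ^ k p) = 0" using zero by blast
  then have "(\<Prod>p\<in>S. x p ^ k p) \<in> P"
    using P by (simp add: primeideal_type_ring_iff ideal_type_ring_iff)
  then show False
    using prime_prodD[OF P] prime_powerD[OF P] x(2) by blast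
qed

context ideal_adic
begin

text \<open>A uniform substitute for the vanishing of \<open>\<mm>\<close>-torsion inside \<open>\<mm>\<^sup>e\<close>. With \<open>s\<close> as in the
  introduction, dimension one gives \<open>\<mm>\<^bsup>K q\<^esup> \<subseteq> (s\<^sup>K)\<close>, which plays the role of the Artin-Rees lemma:
  from \<open>s\<^sup>\<rho> a \<in> \<mm>\<^bsup>K q\<^esup>\<close> it yields an element of \<open>(s\<^bsup>K - \<rho>\<^esup>)\<close> that differs from \<open>a\<close> by something
  that \<open>s\<^sup>\<rho>\<close> annihilates, and no nonzero element of \<open>\<mm>\<^sup>e\<close> is annihilated by \<open>s\<^sup>\<rho>\<close>.\<close>

lemma pw_colon_pw_subset:
  assumes noeth: "noetherian_ring (type_ring :: 'a ring)"
    and local: "local_ring type_ring \<mm>"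
    and dim: "krull_dim (type_ring :: 'a ring) \<le> 1"
    and S: "\<And>p. p \<in> S \<Longrightarrow> primeideal p type_ring"
    and Q: "reduced_primary_decomposition type_ring {0} S Q"
    and e: "\<mm> \<in> S \<Longrightarrow> pw e \<subseteq> Q \<mm>"
  shows "\<exists>K. \<forall>a\<in>pw e. (\<forall>b\<in>pw \<rho>. b * a \<in> pw K) \<longrightarrow> a \<in> pw M"
proof -
  have max: "maximalideal \<mm> type_ring" using local by (simp add: local_ring_def)
  have m_prime: "primeideal \<mm> type_ring"
    by (rule cring.maximalideal_prime[OF type_ring_cring max])
  have prime_sub: "p \<subseteq> \<mm>" if "primeideal p type_ring" for p
    using that by (intro local_ring_proper_subset[OF noeth local]) (auto simp: primeideal_type_ring_iff)
  have fin: "finite S" and zero: "(\<Inter>p\<in>S. Q p) = {0}"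
    and primary: "\<And>p. p \<in> S \<Longrightarrow> primary_ideal (Q p) type_ring"
    and rad: "\<And>p. p \<in> S \<Longrightarrow> ideal_radical type_ring (Q p) = p"
    using Q by (auto simp: reduced_primary_decomposition_def)
  have "\<exists>s\<in>\<mm>. \<forall>p\<in>S - {\<mm>}. s \<notin> p"
    using fin S prime_sub by (intro prime_avoidance ideal_m) blast+
  then obtain s where s: "s \<in> \<mm>" "\<And>p. p \<in> S \<Longrightarrow> p \<noteq> \<mm> \<Longrightarrow> s \<notin> p" by blast
  have "P = \<mm>" if P: "primeideal P type_ring" "s \<in> P" for P
  proof (rule ccontr)
    assume ne: "P \<noteq> \<mm>"
    obtain p where p: "p \<in> S" "p \<subseteq> P" using prime_contains_component[OF Q P(1)] by blast
    have "p \<noteq> \<mm>" using p prime_sub[OF P(1)] ne by blast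
    then have "p \<noteq> P" using s(2)[OF p(1)] P(2) by blast
    then show False
      using no_prime_chain_if_dim_le_1[OF dim S[OF p(1)] P(1) m_prime] p prime_sub[OF P(1)] ne by blast
  qed
  then obtain q where q: "pw q \<subseteq> range ((*) s)"
    using pw_subset_principal[OF noeth] by blast
  have pw_power: "pw (k * q) \<subseteq> range ((*) (s ^ k))" for k
  proof (induction k)
    case 0
    show ?case by (simp add: image_def)
  next
    case (Suc k)
    have "x \<in> range ((*) (s ^ Suc k))" if "x \<in> pw (q + k * q)" for x
      using that
    proof (induction rule: pw_add_induct)
      case (mult a b)
      with q Suc obtain u w where "a = s * u" "b = s ^ k * w" by blast
      then have "a * b = s ^ Suc k * (u * w)" by (simp add: algebra_simps)
      then show ?case by blast
    next
      case (add a b)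
      then show ?case by (rule ideal_add[OF principal_ideal_type_ring])
    qed
    then show ?case by auto
  qed
  have torsion_zero: "d = 0" if d: "d \<in> pw e" "s ^ \<rho> * d = 0" for d
  proof -
    have "d \<in> Q p" if p: "p \<in> S" for p
    proof (cases "p = \<mm>")
      case True
      then show ?thesis using e d(1) p by blast
    next
      case False
      have "s ^ \<rho> \<notin> p" using prime_powerD[OF S[OF p]] s(2)[OF p False] by blast
      moreover have "d * s ^ \<rho> \<in> Q p"
        using d(2) primary[OF p] by (simp add: primary_ideal_def ideal_0 mult.commute)
      ultimately show ?thesis
        using primary[OF p] rad[OF p] by (auto simp: primary_ideal_def)
    qed
    then show ?thesis using zero by blast
  qed
  \<comment> \<open>With this \<open>K\<close>, the exponent \<open>K - \<rho>\<close> is at least both \<open>e\<close>, for \<open>torsion_zero\<close>, and \<open>M\<close>.\<close>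
  define K where "K = \<rho> + e + M"
  have "a \<in> pw M" if a: "a \<in> pw e" "\<forall>b\<in>pw \<rho>. b * a \<in> pw (K * q)" for a
  proof -
    have s_pw: "s ^ i \<in> pw i" for i
      using power_in_pw[of s "Suc 0" i] s(1) pw_1 by simp
    from a(2) s_pw[of \<rho>] pw_power[of K] obtain w where "s ^ \<rho> * a = s ^ K * w" by blast
    then have "s ^ \<rho> * (a - s ^ (e + M) * w) = 0"
      by (simp add: K_def right_diff_distrib power_add mult.assoc)
    moreover have "s ^ (e + M) * w \<in> pw (e + M)" by (intro pw_mult_right s_pw)
    ultimately have "a = s ^ (e + M) * w"
      using torsion_zero[of "a - s ^ (e + M) * w"] a(1) pw_minus[OF a(1)]
        pw_antimonoD[of "s ^ (e + M) * w" "e + M" e] by simp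
    then show ?thesis
      using \<open>s ^ (e + M) * w \<in> pw (e + M)\<close> pw_antimonoD[of a "e + M" M] by simp
  qed
  then show ?thesis by blast
qed

end

section \<open>Evaluation and Taylor expansion of polynomials\<close>

definition eval_mpoly :: "(nat \<Rightarrow> 'a) \<Rightarrow> 'a::comm_ring_1 mpoly \<Rightarrow> 'a" where
  "eval_mpoly y p = (\<Sum>t\<in>Poly_Mapping.keys p.
     Poly_Mapping.lookup p t * (\<Prod>i\<in>Poly_Mapping.keys t. y i ^ Poly_Mapping.lookup t i))"

lemma sum_keys_superset:
  assumes "finite T" "Poly_Mapping.keys p \<subseteq> T" "\<And>t. h t 0 = 0"
  shows "(\<Sum>t\<in>Poly_Mapping.keys p. h t (Poly_Mapping.lookup p t)) = (\<Sum>t\<in>T. h t (Poly_Mapping.lookup p t))"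
  using assms by (intro sum.mono_neutral_left) (auto simp: in_keys_iff)

lemma sum_keys_add:
  fixes h :: "'k \<Rightarrow> 'a::comm_monoid_add \<Rightarrow> 'b::comm_monoid_add"
  assumes "\<And>t. h t 0 = 0" "\<And>t a b. h t (a + b) = h t a + h t b"
  shows "(\<Sum>t\<in>Poly_Mapping.keys (p + q). h t (Poly_Mapping.lookup (p + q) t)) =
    (\<Sum>t\<in>Poly_Mapping.keys p. h t (Poly_Mapping.lookup p t)) +
    (\<Sum>t\<in>Poly_Mapping.keys q. h t (Poly_Mapping.lookup q t))"
proof -
  let ?T = "Poly_Mapping.keys p \<union> Poly_Mapping.keys q"
  have ext: "(\<Sum>t\<in>Poly_Mapping.keys u. h t (Poly_Mapping.lookup u t)) =
      (\<Sum>t\<in>?T. h t (Poly_Mapping.lookup u t))" if "Poly_Mapping.keys u \<subseteq> ?T" for u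
    using that assms(1) by (intro sum_keys_superset) auto
  show ?thesis
    unfolding ext[OF Poly_Mapping.keys_add] ext[OF Un_upper1] ext[OF Un_upper2]
    by (simp add: lookup_add assms(2) sum.distrib)
qed

lemma eval_mpoly_add: "eval_mpoly y (p + q) = eval_mpoly y p + eval_mpoly y q"
  unfolding eval_mpoly_def by (rule sum_keys_add) (simp_all add: distrib_right)

lemma eval_mpoly_single:
  "eval_mpoly y (Poly_Mapping.single t a) =
     a * (\<Prod>i\<in>Poly_Mapping.keys t. y i ^ Poly_Mapping.lookup t i)"
  by (cases "a = 0") (simp_all add: eval_mpoly_def)

lemma eval_mpoly_0 [simp]: "eval_mpoly y 0 = 0"
  by (simp add: eval_mpoly_def)

lemma eval_mpoly_const [simp]: "eval_mpoly y (mpoly_const a) = a"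
  by (simp add: mpoly_const_def eval_mpoly_single)

lemma eval_mpoly_1 [simp]: "eval_mpoly y 1 = 1"
  using eval_mpoly_const[of y 1] by (simp add: mpoly_const_def)

lemma eval_mpoly_var [simp]: "eval_mpoly y (mpoly_var i) = y i"
  by (simp add: mpoly_var_def eval_mpoly_single)

lemma eval_mpoly_sum: "eval_mpoly y (sum g T) = (\<Sum>x\<in>T. eval_mpoly y (g x))"
  by (induction T rule: infinite_finite_induct) (simp_all add: eval_mpoly_add)

lemma monomial_eval_add:
  fixes y :: "nat \<Rightarrow> 'a::comm_ring_1"
  shows "(\<Prod>i\<in>Poly_Mapping.keys (s + t). y i ^ Poly_Mapping.lookup (s + t) i) =
    (\<Prod>i\<in>Poly_Mapping.keys s. y i ^ Poly_Mapping.lookup s i) *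
    (\<Prod>i\<in>Poly_Mapping.keys t. y i ^ Poly_Mapping.lookup t i)"
proof -
  let ?T = "Poly_Mapping.keys s \<union> Poly_Mapping.keys t"
  have ext: "(\<Prod>i\<in>Poly_Mapping.keys u. y i ^ Poly_Mapping.lookup u i) =
      (\<Prod>i\<in>?T. y i ^ Poly_Mapping.lookup u i)" if "Poly_Mapping.keys u \<subseteq> ?T" for u
    using that by (intro prod.mono_neutral_left) (auto simp: in_keys_iff)
  show ?thesis
    unfolding ext[OF Poly_Mapping.keys_add] ext[OF Un_upper1] ext[OF Un_upper2]
    by (simp add: lookup_add power_add prod.distrib)
qed

lemma mpoly_sum_monomials:
  "p = (\<Sum>t\<in>Poly_Mapping.keys p. Poly_Mapping.single t (Poly_Mapping.lookup p t))"
proof (rule poly_mapping_eqI)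
  fix k
  show "Poly_Mapping.lookup p k = Poly_Mapping.lookup
      (\<Sum>t\<in>Poly_Mapping.keys p. Poly_Mapping.single t (Poly_Mapping.lookup p t)) k"
    by (auto simp: lookup_sum lookup_single when_def in_keys_iff)
qed

lemma eval_mpoly_mult:
  "eval_mpoly y (p * q) = eval_mpoly y p * eval_mpoly y q"
proof -
  have single: "eval_mpoly y (Poly_Mapping.single s a * Poly_Mapping.single t b) =
      eval_mpoly y (Poly_Mapping.single s a) * eval_mpoly y (Poly_Mapping.single t b)" for s t a b
    by (simp add: mult_single eval_mpoly_single monomial_eval_add mult_ac)
  let ?m = "\<lambda>p t. Poly_Mapping.single t (Poly_Mapping.lookup p t)"
  have "eval_mpoly y ((\<Sum>s\<in>Poly_Mapping.keys p. ?m p s) * (\<Sum>t\<in>Poly_Mapping.keys q. ?m q t)) =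
    eval_mpoly y (\<Sum>s\<in>Poly_Mapping.keys p. ?m p s) * eval_mpoly y (\<Sum>t\<in>Poly_Mapping.keys q. ?m q t)"
    by (simp only: sum_product eval_mpoly_sum single)
  then show ?thesis
    by (simp only: mpoly_sum_monomials[symmetric])
qed

lemma mpoly_ring_simps [simp]:
  "p \<otimes>\<^bsub>mpoly_ring n\<^esub> q = p * q" "p \<oplus>\<^bsub>mpoly_ring n\<^esub> q = p + q"
  "\<zero>\<^bsub>mpoly_ring n\<^esub> = 0" "\<one>\<^bsub>mpoly_ring n\<^esub> = 1"
  by (simp_all add: mpoly_ring_def ring_of_type_algebra_def)

lemma carrier_mpoly_ring:
  "carrier (mpoly_ring n) = {p. \<forall>t\<in>Poly_Mapping.keys p. Poly_Mapping.keys t \<subseteq> {..<n}}"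
  by (simp add: mpoly_ring_def)

lemma mpoly_ring_0: "0 \<in> carrier (mpoly_ring n)"
  and mpoly_ring_1: "1 \<in> carrier (mpoly_ring n)"
  and mpoly_ring_const: "mpoly_const a \<in> carrier (mpoly_ring n)"
  and mpoly_ring_var: "i < n \<Longrightarrow> mpoly_var i \<in> carrier (mpoly_ring n)"
  by (auto simp: carrier_mpoly_ring mpoly_const_def mpoly_var_def split: if_splits)

lemma mpoly_ring_uminus: "p \<in> carrier (mpoly_ring n) \<Longrightarrow> - p \<in> carrier (mpoly_ring n)"
  by (auto simp: carrier_mpoly_ring in_keys_iff)

lemma mpoly_ring_add:
  "p \<in> carrier (mpoly_ring n) \<Longrightarrow> q \<in> carrier (mpoly_ring n) \<Longrightarrow> p + q \<in> carrier (mpoly_ring n)"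
  using Poly_Mapping.keys_add[of p q] by (fastforce simp: carrier_mpoly_ring)

lemma mpoly_ring_mult:
  "p \<in> carrier (mpoly_ring n) \<Longrightarrow> q \<in> carrier (mpoly_ring n) \<Longrightarrow> p * q \<in> carrier (mpoly_ring n)"
proof -
  assume pq: "p \<in> carrier (mpoly_ring n)" "q \<in> carrier (mpoly_ring n)"
  have "Poly_Mapping.keys t \<subseteq> {..<n}" if t: "t \<in> Poly_Mapping.keys (p * q)" for t
  proof -
    from t keys_mult[of p q] obtain a b where
      ab: "t = a + b" "a \<in> Poly_Mapping.keys p" "b \<in> Poly_Mapping.keys q" by blast
    show ?thesis
      using pq ab Poly_Mapping.keys_add[of a b] unfolding carrier_mpoly_ring by blast
  qed
  then show ?thesis by (simp add: carrier_mpoly_ring)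
qed

lemma mpoly_ring_sum:
  "(\<And>x. x \<in> T \<Longrightarrow> g x \<in> carrier (mpoly_ring n)) \<Longrightarrow> sum g T \<in> carrier (mpoly_ring n)"
  by (induction T rule: infinite_finite_induct) (auto intro: mpoly_ring_0 mpoly_ring_add)

lemma mpoly_ring_prod:
  "(\<And>x. x \<in> T \<Longrightarrow> g x \<in> carrier (mpoly_ring n)) \<Longrightarrow> prod g T \<in> carrier (mpoly_ring n)"
  by (induction T rule: infinite_finite_induct) (auto intro: mpoly_ring_1 mpoly_ring_mult)

lemma mpoly_ring_cring: "cring (mpoly_ring n :: 'a::comm_ring_1 mpoly ring)"
proof (rule cringI)
  have inv: "\<exists>q\<in>carrier (mpoly_ring n). q \<oplus>\<^bsub>mpoly_ring n\<^esub> p = \<zero>\<^bsub>mpoly_ring n\<^esub>"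
    if "p \<in> carrier (mpoly_ring n)" for p :: "'a mpoly"
    using mpoly_ring_uminus[OF that] by (auto intro!: bexI[of _ "- p"])
  show "abelian_group (mpoly_ring n :: 'a mpoly ring)"
    by (rule abelian_groupI)
      (use inv in \<open>auto simp: mpoly_ring_add mpoly_ring_0 algebra_simps\<close>)
  show "Group.comm_monoid (mpoly_ring n :: 'a mpoly ring)"
    by (rule comm_monoidI) (auto simp: mpoly_ring_mult mpoly_ring_1 algebra_simps)
qed (simp_all add: algebra_simps)

lemma keys_minus_nat:
  fixes s t :: "'k \<Rightarrow>\<^sub>0 nat"
  shows "Poly_Mapping.keys (t - s) \<subseteq> Poly_Mapping.keys t"
proof
  fix x assume "x \<in> Poly_Mapping.keys (t - s)"
  then show "x \<in> Poly_Mapping.keys t"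
    by (cases "Poly_Mapping.lookup t x = 0") (auto simp: in_keys_iff lookup_minus)
qed

text \<open>Restricting the product rule to a variable times a single term spares the user of the induction
  the general Leibniz rule for \<open>mpoly_deriv\<close>.\<close>

lemma mpoly_ring_induct [consumes 1, case_names const var_mult add]:
  assumes p: "p \<in> carrier (mpoly_ring n)"
    and const: "\<And>a. P (mpoly_const a)"
    and var_mult: "\<And>i t a. i < n \<Longrightarrow> Poly_Mapping.single t a \<in> carrier (mpoly_ring n) \<Longrightarrow>
      P (Poly_Mapping.single t a) \<Longrightarrow> P (mpoly_var i * Poly_Mapping.single t a)"
    and add: "\<And>p q. p \<in> carrier (mpoly_ring n) \<Longrightarrow> q \<in> carrier (mpoly_ring n) \<Longrightarrow>
      P p \<Longrightarrow> P q \<Longrightarrow> P (p + q)"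
  shows "P p"
proof -
  have mono: "P (Poly_Mapping.single t a)" if "Poly_Mapping.keys t \<subseteq> {..<n}" for t a
    using that
  proof (induction "\<Sum>i<n. Poly_Mapping.lookup t i" arbitrary: t)
    case 0
    then have "Poly_Mapping.lookup t i = 0" for i
      by (cases "i < n") (auto simp: not_in_keys_iff_lookup_eq_zero[symmetric])
    then have "t = 0" by (intro poly_mapping_eqI) simp
    then show ?case using const[of a] by (simp add: mpoly_const_def)
  next
    case (Suc d)
    then obtain i where i: "i < n" "Poly_Mapping.lookup t i \<noteq> 0"
      by (metis lessThan_iff nat.distinct(1) sum.neutral)
    define u where "u = t - Poly_Mapping.single i 1"
    have t: "t = Poly_Mapping.single i 1 + u"
      using i by (intro poly_mapping_eqI) (auto simp: u_def lookup_add lookup_minus lookup_single when_def)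
    have keys_u: "Poly_Mapping.keys u \<subseteq> {..<n}"
      unfolding u_def by (rule order_trans[OF keys_minus_nat Suc.prems])
    have "(\<Sum>i<n. Poly_Mapping.lookup t i) = 1 + (\<Sum>i<n. Poly_Mapping.lookup u i)"
      using i by (simp add: t lookup_add sum.distrib lookup_single when_def)
    with Suc.hyps have "P (Poly_Mapping.single u a)" using keys_u by simp
    moreover have "Poly_Mapping.single u a \<in> carrier (mpoly_ring n)"
      using keys_u by (simp add: carrier_mpoly_ring)
    moreover have "Poly_Mapping.single t a = mpoly_var i * Poly_Mapping.single u a"
      by (simp add: t mpoly_var_def mult_single)
    ultimately show ?case using var_mult[OF i(1)] by simp
  qed
  have "P (\<Sum>t\<in>T. Poly_Mapping.single t (Poly_Mapping.lookup p t)) \<and>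
      (\<Sum>t\<in>T. Poly_Mapping.single t (Poly_Mapping.lookup p t)) \<in> carrier (mpoly_ring n)"
    if "finite T" "T \<subseteq> Poly_Mapping.keys p" for T
    using that
  proof (induction T)
    case empty
    show ?case using const[of 0] by (simp add: mpoly_const_def mpoly_ring_0)
  next
    case (insert t T)
    have t: "Poly_Mapping.keys t \<subseteq> {..<n}"
      using p insert.prems by (auto simp: carrier_mpoly_ring)
    then have "Poly_Mapping.single t (Poly_Mapping.lookup p t) \<in> carrier (mpoly_ring n)"
      by (simp add: carrier_mpoly_ring)
    then show ?case
      using insert mono[OF t] by (auto intro: add mpoly_ring_add)
  qed
  from this[of "Poly_Mapping.keys p"] show ?thesis
    by (simp add: mpoly_sum_monomials[symmetric])
qed

lemma eval_mpoly_cong_mod: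
  assumes S: "ideal S type_ring" and y: "\<And>i. i < n \<Longrightarrow> y' i - y i \<in> S"
    and p: "p \<in> carrier (mpoly_ring n)"
  shows "eval_mpoly y' p - eval_mpoly y p \<in> S"
  using p
proof (induction rule: mpoly_ring_induct)
  case (const a)
  show ?case by (simp add: ideal_0[OF S])
next
  case (var_mult i t a)
  let ?q = "Poly_Mapping.single t a"
  have "y' i * (eval_mpoly y' ?q - eval_mpoly y ?q) + eval_mpoly y ?q * (y' i - y i) \<in> S"
    using var_mult y by (intro ideal_add[OF S] ideal_mult_left[OF S]) auto
  then show ?case by (simp add: eval_mpoly_mult algebra_simps)
next
  case (add p q)
  then have "(eval_mpoly y' p - eval_mpoly y p) + (eval_mpoly y' q - eval_mpoly y q) \<in> S"
    by (intro ideal_add[OF S])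
  then show ?case by (simp add: eval_mpoly_add algebra_simps)
qed

lemma mpoly_deriv_add: "mpoly_deriv i (p + q) = mpoly_deriv i p + mpoly_deriv i q"
  unfolding mpoly_deriv_def
  by (rule sum_keys_add) (simp_all add: distrib_left single_add)

lemma mpoly_deriv_single:
  "mpoly_deriv i (Poly_Mapping.single t a) =
     Poly_Mapping.single (t - Poly_Mapping.single i 1) (of_nat (Poly_Mapping.lookup t i) * a)"
  by (cases "a = 0") (simp_all add: mpoly_deriv_def)

lemma mpoly_deriv_const: "mpoly_deriv i (mpoly_const a) = 0"
  by (simp add: mpoly_const_def mpoly_deriv_single)

text \<open>The case \<open>l = i\<close> with \<open>i\<close> absent from \<open>t\<close> needs care: the truncated exponent of
  \<open>t - single i 1\<close> is then wrong, but its coefficient vanishes.\<close>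

lemma mpoly_deriv_var_mult:
  "mpoly_deriv l (mpoly_var i * Poly_Mapping.single t a) =
     mpoly_var i * mpoly_deriv l (Poly_Mapping.single t a) +
     (if l = i then Poly_Mapping.single t a else 0)"
proof -
  let ?e = "\<lambda>i. Poly_Mapping.single i (1::nat)"
  show ?thesis
  proof (cases "l = i")
    case False
    have shift: "?e i + t - ?e l = ?e i + (t - ?e l)"
    proof (rule poly_mapping_eqI)
      fix k
      show "Poly_Mapping.lookup (?e i + t - ?e l) k = Poly_Mapping.lookup (?e i + (t - ?e l)) k"
        unfolding lookup_add lookup_minus lookup_single when_def using False by simp
    qed
    have "mpoly_deriv l (mpoly_var i * Poly_Mapping.single t a) =
        Poly_Mapping.single (?e i + (t - ?e l)) (of_nat (Poly_Mapping.lookup t l) * a)"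
      unfolding mpoly_var_def mult_single mpoly_deriv_single shift mult_1_left
        lookup_add lookup_single when_def if_not_P[OF not_sym[OF False]] add_0_left ..
    also have "\<dots> = mpoly_var i * mpoly_deriv l (Poly_Mapping.single t a)"
      unfolding mpoly_var_def mpoly_deriv_single mult_single mult_1_left ..
    finally show ?thesis using False by (simp only: if_False add_0_right)
  next
    case True
    have cancel: "?e i + t - ?e i = t" by (rule add_diff_cancel_left')
    have shift: "Poly_Mapping.single (?e i + (t - ?e i)) (of_nat (Poly_Mapping.lookup t i) * a) =
        Poly_Mapping.single t (of_nat (Poly_Mapping.lookup t i) * a)"
    proof (cases "Poly_Mapping.lookup t i = 0")
      case False
      have "?e i + (t - ?e i) = t"
      proof (rule poly_mapping_eqI)
        fix k
        show "Poly_Mapping.lookup (?e i + (t - ?e i)) k = Poly_Mapping.lookup t k"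
          unfolding lookup_add lookup_minus lookup_single when_def using False by auto
      qed
      then show ?thesis by (rule arg_cong)
    next
      case True
      then show ?thesis by (simp only: of_nat_0 mult_zero_left single_zero)
    qed
    have "mpoly_deriv i (mpoly_var i * Poly_Mapping.single t a) =
        Poly_Mapping.single t (of_nat (1 + Poly_Mapping.lookup t i) * a)"
      unfolding mpoly_var_def mult_single mpoly_deriv_single cancel mult_1_left
        lookup_add lookup_single_eq ..
    also have "\<dots> = Poly_Mapping.single t (of_nat (Poly_Mapping.lookup t i) * a) + Poly_Mapping.single t a"
      by (simp add: single_add[symmetric] distrib_right add.commute)
    also have "Poly_Mapping.single t (of_nat (Poly_Mapping.lookup t i) * a) =
        mpoly_var i * mpoly_deriv i (Poly_Mapping.single t a)"
      unfolding mpoly_var_def mpoly_deriv_single mult_single mult_1_left shift ..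
    finally show ?thesis using True by (simp only: simp_thms if_True)
  qed
qed

lemma mpoly_ring_deriv:
  assumes "p \<in> carrier (mpoly_ring n)"
  shows "mpoly_deriv i p \<in> carrier (mpoly_ring n)"
proof -
  have "Poly_Mapping.single (t - Poly_Mapping.single i 1) a \<in> carrier (mpoly_ring n)"
    if "t \<in> Poly_Mapping.keys p" for t and a :: 'a
    using that assms keys_minus_nat[of t "Poly_Mapping.single i 1"]
    by (auto simp: carrier_mpoly_ring split: if_splits)
  then show ?thesis
    unfolding mpoly_deriv_def by (intro mpoly_ring_sum)
qed

context ideal_adic
begin

text \<open>For \<open>y\<^sub>i q\<close> the remainder is \<open>(y\<^sub>i + z\<^sub>i) R + z\<^sub>i D\<close>, where \<open>R\<close> is the remainder of \<open>q\<close> and \<open>D\<close>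
  its linear term; both summands are of order two in \<open>z\<close>.\<close>

lemma taylor_mod:
  assumes z: "\<And>i. i < n \<Longrightarrow> z i \<in> pw j" and p: "p \<in> carrier (mpoly_ring n)"
  shows "eval_mpoly (\<lambda>i. y i + z i) p - eval_mpoly y p
    - (\<Sum>l<n. eval_mpoly y (mpoly_deriv l p) * z l) \<in> pw (j + j)"
  using p
proof (induction rule: mpoly_ring_induct)
  case (const a)
  show ?case by (simp add: mpoly_deriv_const pw_zero)
next
  case (var_mult i t a)
  let ?q = "Poly_Mapping.single t a"
  let ?y' = "\<lambda>i. y i + z i"
  let ?D = "\<Sum>l<n. eval_mpoly y (mpoly_deriv l ?q) * z l"
  define R where "R = eval_mpoly ?y' ?q - eval_mpoly y ?q - ?D"
  have R: "R \<in> pw (j + j)" using var_mult by (simp add: R_def)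
  have "?D \<in> pw j" using z by (intro pw_sum pw_mult_left) auto
  then have zD: "z i * ?D \<in> pw (j + j)" using z var_mult by (intro pw_mult) auto
  have "(\<Sum>l<n. eval_mpoly y (mpoly_deriv l (mpoly_var i * ?q)) * z l) =
      (\<Sum>l<n. y i * (eval_mpoly y (mpoly_deriv l ?q) * z l) + (if l = i then eval_mpoly y ?q * z i else 0))"
    by (intro sum.cong) (auto simp: mpoly_deriv_var_mult eval_mpoly_add eval_mpoly_mult algebra_simps)
  also have "\<dots> = y i * ?D + eval_mpoly y ?q * z i"
    using var_mult by (simp add: sum.distrib sum_distrib_left)
  finally have "eval_mpoly ?y' (mpoly_var i * ?q) - eval_mpoly y (mpoly_var i * ?q)
      - (\<Sum>l<n. eval_mpoly y (mpoly_deriv l (mpoly_var i * ?q)) * z l) = (y i + z i) * R + z i * ?D"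
    by (simp add: R_def eval_mpoly_mult algebra_simps)
  also have "\<dots> \<in> pw (j + j)" by (rule pw_plus[OF pw_mult_left[OF R] zD])
  finally show ?case .
next
  case (add p q)
  from pw_plus[OF add.IH] show ?case
    by (simp add: eval_mpoly_add mpoly_deriv_add distrib_right sum.distrib algebra_simps)
qed

end

section \<open>Newton iteration with the Jacobian ideal\<close>

lemma eval_mpoly_hom: "ring_hom_ring (mpoly_ring n) (type_ring :: 'a::comm_ring_1 ring) (eval_mpoly y)"
  by (rule ring_hom_ringI[OF cring.axioms(1)[OF mpoly_ring_cring] type_ring_ring])
    (simp_all add: eval_mpoly_mult eval_mpoly_add)

text \<open>The polynomials whose value at \<open>y\<close> lies in \<open>T\<close> form an ideal, so it is enough to look at the
  generators.\<close>

lemma eval_mpoly_genideal: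
  assumes p: "p \<in> genideal (mpoly_ring n) G" and G: "G \<subseteq> carrier (mpoly_ring n)"
    and T: "ideal T type_ring" and gen: "\<And>g. g \<in> G \<Longrightarrow> eval_mpoly y g \<in> T"
  shows "eval_mpoly y p \<in> T"
proof -
  interpret ring "mpoly_ring n :: 'a mpoly ring" by (rule cring.axioms(1)[OF mpoly_ring_cring])
  have "genideal (mpoly_ring n) G \<subseteq> {q \<in> carrier (mpoly_ring n). eval_mpoly y q \<in> T}"
    using G gen by (intro genideal_minimal ring_hom_ring.ideal_vimage[OF eval_mpoly_hom T]) auto
  with p show ?thesis by blast
qed

lemma mpoly_ring_det:
  assumes "\<And>i j. i < r \<Longrightarrow> j < r \<Longrightarrow> M i j \<in> carrier (mpoly_ring n)"
  shows "det (mat r r (\<lambda>(i, j). M i j)) \<in> carrier (mpoly_ring n)"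
proof -
  have "signof p * (\<Prod>i = 0..<r. mat r r (\<lambda>(i, j). M i j) $$ (i, p i)) \<in> carrier (mpoly_ring n)"
    if "p permutes {0..<r}" for p
  proof (rule mpoly_ring_mult)
    show "signof p \<in> carrier (mpoly_ring n)"
      by (auto simp: sign_def mpoly_ring_1 mpoly_ring_uminus)
    show "(\<Prod>i = 0..<r. mat r r (\<lambda>(i, j). M i j) $$ (i, p i)) \<in> carrier (mpoly_ring n)"
      using assms permutes_in_image[OF that] by (intro mpoly_ring_prod) auto
  qed
  then show ?thesis
    by (subst det_def'[of _ r]) (auto intro!: mpoly_ring_sum)
qed

lemma jacobian_minor_carrier:
  assumes "\<And>i. i < r \<Longrightarrow> f i \<in> carrier (mpoly_ring n)"
  shows "jacobian_minor r f s \<in> carrier (mpoly_ring n)"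
  unfolding jacobian_minor_def using assms by (intro mpoly_ring_det mpoly_ring_deriv)

text \<open>Cramer's rule: apply the adjugate of the chosen square block to \<open>w\<close> and put zeros in the remaining
  columns.\<close>

lemma jacobian_minor_solves:
  assumes s: "s ` {..<r} \<subseteq> {..<n}" and S: "ideal S type_ring" and w: "\<And>i. i < r \<Longrightarrow> w i \<in> S"
  shows "\<exists>z. (\<forall>l. z l \<in> S) \<and> (\<forall>i<r.
    (\<Sum>l<n. eval_mpoly y (mpoly_deriv l (f i)) * z l) = eval_mpoly y (jacobian_minor r f s) * w i)"
proof -
  define M where "M = mat r r (\<lambda>(i, j). mpoly_deriv (s j) (f i))"
  define C where "C j k = adj_mat M $$ (j, k)" for j k
  have M: "M \<in> carrier_mat r r" by (simp add: M_def)
  have adj: "(\<Sum>j<r. mpoly_deriv (s j) (f i) * C j k) = (if i = k then jacobian_minor r f s else 0)"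
    if "i < r" "k < r" for i k
  proof -
    have "(M * adj_mat M) $$ (i, k) = (\<Sum>j<r. mpoly_deriv (s j) (f i) * C j k)"
      using that M adj_mat(1)[OF M]
      by (simp add: C_def scalar_prod_def M_def atLeast0LessThan)
    moreover have "(M * adj_mat M) $$ (i, k) = (if i = k then det M else 0)"
      using that by (simp add: adj_mat(2)[OF M])
    ultimately show ?thesis by (simp add: jacobian_minor_def M_def)
  qed
  define W where "W j = (\<Sum>k<r. eval_mpoly y (C j k) * w k)" for j
  define z where "z l = (\<Sum>j<r. if s j = l then W j else 0)" for l
  have "z l \<in> S" for l
    using w unfolding z_def W_def
    by (auto intro!: ideal_sum[OF S] ideal_mult_left[OF S] ideal_0[OF S])
  moreover have "(\<Sum>l<n. eval_mpoly y (mpoly_deriv l (f i)) * z l) =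
      eval_mpoly y (jacobian_minor r f s) * w i" if i: "i < r" for i
  proof -
    let ?D = "\<lambda>l. eval_mpoly y (mpoly_deriv l (f i))"
    have "(\<Sum>l<n. ?D l * z l) = (\<Sum>j<r. \<Sum>l<n. if l = s j then ?D l * W j else 0)"
      unfolding z_def sum_distrib_left by (subst sum.swap) (intro sum.cong refl; simp)
    also have "\<dots> = (\<Sum>j<r. ?D (s j) * W j)"
      using s by (intro sum.cong refl) auto
    also have "\<dots> = (\<Sum>k<r. \<Sum>j<r. ?D (s j) * eval_mpoly y (C j k) * w k)"
      unfolding W_def sum_distrib_left by (subst sum.swap) (simp add: mult.assoc)
    also have "\<dots> = (\<Sum>k<r. eval_mpoly y (\<Sum>j<r. mpoly_deriv (s j) (f i) * C j k) * w k)"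
      by (simp add: eval_mpoly_sum eval_mpoly_mult sum_distrib_right)
    also have "\<dots> = (\<Sum>k<r. if i = k then eval_mpoly y (jacobian_minor r f s) * w i else 0)"
      using i by (intro sum.cong refl) (auto simp: adj)
    also have "\<dots> = eval_mpoly y (jacobian_minor r f s) * w i"
      using i by simp
    finally show ?thesis .
  qed
  ultimately show ?thesis by blast
qed

text \<open>The factors \<open>x\<close> for which all systems \<open>J z = x w\<close> are solvable form an ideal of the base ring, and
  it contains the values of the maximal minors.\<close>

lemma jacobian_ideal_solves:
  assumes f: "\<And>i. i < r \<Longrightarrow> f i \<in> carrier (mpoly_ring n)"
    and d: "d \<in> jacobian_ideal n r f"
    and S: "ideal S type_ring" and w: "\<And>i. i < r \<Longrightarrow> w i \<in> S"
  shows "\<exists>z. (\<forall>l. z l \<in> S) \<and> (\<forall>i<r.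
    (\<Sum>l<n. eval_mpoly y (mpoly_deriv l (f i)) * z l) = eval_mpoly y d * w i)"
proof -
  let ?D = "\<lambda>i l. eval_mpoly y (mpoly_deriv l (f i))"
  define T where "T = {x. \<forall>w. (\<forall>i<r. w i \<in> S) \<longrightarrow>
    (\<exists>z. (\<forall>l. z l \<in> S) \<and> (\<forall>i<r. (\<Sum>l<n. ?D i l * z l) = x * w i))}"
  have "ideal T type_ring"
    unfolding ideal_type_ring_iff
  proof (intro conjI ballI allI)
    show "0 \<in> T"
      using ideal_0[OF S] by (auto simp: T_def intro!: exI[of _ "\<lambda>_. 0"])
  next
    fix x x' assume xx: "x \<in> T" "x' \<in> T"
    show "x + x' \<in> T"
      unfolding T_def
    proof (rule CollectI, intro allI impI)
      fix w assume w: "\<forall>i<r. w i \<in> S"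
      from xx w obtain z z' where
        z: "\<forall>l. z l \<in> S" "\<forall>i<r. (\<Sum>l<n. ?D i l * z l) = x * w i" and
        z': "\<forall>l. z' l \<in> S" "\<forall>i<r. (\<Sum>l<n. ?D i l * z' l) = x' * w i"
        unfolding T_def by blast
      show "\<exists>z. (\<forall>l. z l \<in> S) \<and> (\<forall>i<r. (\<Sum>l<n. ?D i l * z l) = (x + x') * w i)"
        using z z' by (intro exI[of _ "\<lambda>l. z l + z' l"])
          (auto intro: ideal_add[OF S] simp: distrib_left distrib_right sum.distrib)
    qed
  next
    fix a x assume x: "x \<in> T"
    show "a * x \<in> T"
      unfolding T_def
    proof (rule CollectI, intro allI impI)
      fix w assume w: "\<forall>i<r. w i \<in> S"
      from x w obtain z where z: "\<forall>l. z l \<in> S" "\<forall>i<r. (\<Sum>l<n. ?D i l * z l) = x * w i"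
        unfolding T_def by blast
      have "(\<Sum>l<n. ?D i l * (a * z l)) = a * x * w i" if "i < r" for i
        using z(2) that by (simp add: mult.left_commute[of _ a] sum_distrib_left[symmetric] mult.assoc)
      then show "\<exists>z. (\<forall>l. z l \<in> S) \<and> (\<forall>i<r. (\<Sum>l<n. ?D i l * z l) = a * x * w i)"
        using z(1) by (intro exI[of _ "\<lambda>l. a * z l"]) (auto intro: ideal_mult_left[OF S])
    qed
  qed
  moreover have "eval_mpoly y (jacobian_minor r f s) \<in> T" if "s ` {..<r} \<subseteq> {..<n}" for s
    using jacobian_minor_solves[OF that S] by (auto simp: T_def)
  ultimately have "eval_mpoly y d \<in> T"
    using d f unfolding jacobian_ideal_def
    by (elim eval_mpoly_genideal) (auto intro: jacobian_minor_carrier)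
  with w show ?thesis by (simp add: T_def)
qed

context ideal_adic
begin

text \<open>The condition \<open>\<mm>\<^sup>\<rho> \<subseteq> H(y) + \<mm>\<^bsup>\<rho> + 1\<^esup>\<close>. Unlike \<open>\<mm>\<^sup>\<rho> \<subseteq> H(y)\<close>, it is visibly stable under changing
  \<open>y\<close> modulo \<open>\<mm>\<^bsup>\<rho> + 1\<^esup>\<close>, and iterating it approximates \<open>\<mm>\<^sup>\<rho>\<close> by values of \<open>H\<close> to any order, which
  takes the place of Nakayama's lemma.\<close>

definition values_fill_pw :: "'a mpoly set \<Rightarrow> nat \<Rightarrow> (nat \<Rightarrow> 'a) \<Rightarrow> bool" where
  "values_fill_pw H \<rho> y \<longleftrightarrow> (\<forall>a\<in>pw \<rho>. \<exists>h\<in>H. a - eval_mpoly y h \<in> pw (\<rho> + 1))"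

lemma values_fill_pw_cong:
  assumes fill: "values_fill_pw H \<rho> y" and H: "H \<subseteq> carrier (mpoly_ring n)"
    and y: "\<And>i. i < n \<Longrightarrow> y' i - y i \<in> pw (\<rho> + 1)"
  shows "values_fill_pw H \<rho> y'"
  unfolding values_fill_pw_def
proof
  fix a assume "a \<in> pw \<rho>"
  with fill obtain h where h: "h \<in> H" "a - eval_mpoly y h \<in> pw (\<rho> + 1)"
    by (auto simp: values_fill_pw_def)
  have "eval_mpoly y' h - eval_mpoly y h \<in> pw (\<rho> + 1)"
    using h(1) H y by (intro eval_mpoly_cong_mod[OF ideal_pw, where n = n]) auto
  from pw_minus[OF h(2) this] have "a - eval_mpoly y' h \<in> pw (\<rho> + 1)" by simp
  with h(1) show "\<exists>h\<in>H. a - eval_mpoly y' h \<in> pw (\<rho> + 1)" by blast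
qed

text \<open>An error in \<open>\<mm>\<^bsup>\<rho> + j\<^esup> = \<mm>\<^sup>j \<mm>\<^sup>\<rho>\<close> is again a combination of elements of \<open>\<mm>\<^sup>\<rho>\<close>, to which the
  hypothesis applies.\<close>

lemma values_fill_pw_iterate:
  assumes fill: "values_fill_pw H \<rho> y" and H: "ideal H (mpoly_ring n)" and a: "a \<in> pw \<rho>"
  shows "\<exists>h\<in>H. a - eval_mpoly y h \<in> pw (\<rho> + j)"
  using a
proof (induction j arbitrary: a)
  case 0
  have "0 \<in> H"
    using additive_subgroup.zero_closed[OF ideal.axioms(1)[OF H]] by simp
  with 0 show ?case by (intro bexI[of _ 0]) auto
next
  case (Suc j)
  have H_add: "h + h' \<in> H" if "h \<in> H" "h' \<in> H" for h h'
    using additive_subgroup.a_closed[OF ideal.axioms(1)[OF H] that] by simp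
  have H_mult: "mpoly_const b * h \<in> H" if "h \<in> H" for b h
    using ideal.I_l_closed[OF H that mpoly_ring_const] by simp
  have step: "\<exists>h\<in>H. x - eval_mpoly y h \<in> pw (\<rho> + Suc j)" if "x \<in> pw (j + \<rho>)" for x
    using that
  proof (induction rule: pw_add_induct)
    case (mult b x)
    with fill obtain h where h: "h \<in> H" "x - eval_mpoly y h \<in> pw (\<rho> + 1)"
      by (auto simp: values_fill_pw_def)
    have "b * (x - eval_mpoly y h) \<in> pw (j + (\<rho> + 1))"
      using mult h by (intro pw_mult)
    then show ?case
      using H_mult[OF h(1)] by (intro bexI[of _ "mpoly_const b * h"])
        (auto simp: eval_mpoly_mult algebra_simps)
  next
    case (add x x')
    then obtain h h' where "h \<in> H" "x - eval_mpoly y h \<in> pw (\<rho> + Suc j)"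
      "h' \<in> H" "x' - eval_mpoly y h' \<in> pw (\<rho> + Suc j)" by blast
    then show ?case
      using pw_plus[of "x - eval_mpoly y h" "\<rho> + Suc j" "x' - eval_mpoly y h'"]
      by (intro bexI[of _ "h + h'"]) (auto simp: H_add eval_mpoly_add algebra_simps)
  qed
  from Suc obtain h where h: "h \<in> H" "a - eval_mpoly y h \<in> pw (\<rho> + j)" by blast
  with step[of "a - eval_mpoly y h"] obtain h' where
    h': "h' \<in> H" "a - eval_mpoly y h - eval_mpoly y h' \<in> pw (\<rho> + Suc j)"
    by (auto simp: add.commute)
  then show ?case
    using h(1) by (intro bexI[of _ "h + h'"]) (auto simp: H_add eval_mpoly_add algebra_simps)
qed

text \<open>A vector with entries in \<open>\<mm>\<^sup>K = \<mm>\<^sup>\<rho> \<mm>\<^bsup>K - \<rho>\<^esup>\<close> is a sum of vectors \<open>a b e\<^sub>i\<close> with \<open>a \<in> \<mm>\<^sup>\<rho>\<close> and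
  \<open>b \<in> \<mm>\<^bsup>K - \<rho>\<^esup>\<close>. Replacing \<open>a\<close> by a value \<open>h(y)\<close> costs an error in \<open>\<mm>\<^bsup>\<rho> + 1 + K - \<rho>\<^esup> = \<mm>\<^bsup>K + 1\<^esup>\<close>, and
  the linearised equation for \<open>h(y) b e\<^sub>i\<close> is solved by \<open>jacobian_ideal_solves\<close>. The inequality
  \<open>K \<ge> 2\<rho> + 1\<close> makes the quadratic remainder negligible.\<close>

lemma newton_step:
  assumes f: "\<And>i. i < r \<Longrightarrow> f i \<in> carrier (mpoly_ring n)"
    and H: "H \<subseteq> jacobian_ideal n r f" and fill: "values_fill_pw H \<rho> y"
    and K: "2 * \<rho> + 1 \<le> K" and fy: "\<And>i. i < r \<Longrightarrow> eval_mpoly y (f i) \<in> pw K"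
  obtains z where "\<And>l. z l \<in> pw (K - \<rho>)"
    and "\<And>i. i < r \<Longrightarrow> eval_mpoly (\<lambda>l. y l + z l) (f i) \<in> pw (Suc K)"
proof -
  let ?J = "\<lambda>i z. \<Sum>l<n. eval_mpoly y (mpoly_deriv l (f i)) * z l"
  have solve: "\<exists>z. (\<forall>l. z l \<in> pw (K - \<rho>)) \<and>
      (\<forall>i'<r. ?J i' z - (if i' = i then x else 0) \<in> pw (Suc K))" if "x \<in> pw K" for i x
  proof -
    have "x \<in> pw (\<rho> + (K - \<rho>))" using that K by simp
    then show ?thesis
    proof (induction rule: pw_add_induct)
      case (mult a b)
      from mult fill obtain h where h: "h \<in> H" "a - eval_mpoly y h \<in> pw (\<rho> + 1)"
        by (auto simp: values_fill_pw_def)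
      have "\<exists>z. (\<forall>l. z l \<in> pw (K - \<rho>)) \<and>
          (\<forall>i'<r. ?J i' z = eval_mpoly y h * (if i' = i then b else 0))"
        using h(1) H mult f by (intro jacobian_ideal_solves ideal_pw) (auto intro: pw_zero)
      then obtain z where z: "\<And>l. z l \<in> pw (K - \<rho>)"
        "\<And>i'. i' < r \<Longrightarrow> ?J i' z = eval_mpoly y h * (if i' = i then b else 0)" by blast
      have "(eval_mpoly y h - a) * b \<in> pw (\<rho> + 1 + (K - \<rho>))"
        using h(2) mult(2) pw_uminus[OF h(2)] by (intro pw_mult) auto
      then have "(eval_mpoly y h - a) * b \<in> pw (Suc K)" using K by simp
      with z show ?case
        by (intro exI[of _ z]) (auto simp: pw_zero left_diff_distrib)
    next
      case (add x x')
      then obtain z z' where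
        z: "\<forall>l. z l \<in> pw (K - \<rho>)" "\<forall>i'<r. ?J i' z - (if i' = i then x else 0) \<in> pw (Suc K)" and
        z': "\<forall>l. z' l \<in> pw (K - \<rho>)" "\<forall>i'<r. ?J i' z' - (if i' = i then x' else 0) \<in> pw (Suc K)"
        by blast
      have split: "?J i' (\<lambda>l. z l + z' l) - (if i' = i then x + x' else 0) =
          (?J i' z - (if i' = i then x else 0)) + (?J i' z' - (if i' = i then x' else 0))" for i'
        by (simp add: distrib_left sum.distrib)
      have "?J i' (\<lambda>l. z l + z' l) - (if i' = i then x + x' else 0) \<in> pw (Suc K)" if "i' < r" for i'
        unfolding split using z z' that by (intro pw_plus) blast+
      then show ?case
        using z z' by (intro exI[of _ "\<lambda>l. z l + z' l"]) (blast intro: pw_plus)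
    qed
  qed
  have "\<exists>Z. \<forall>i. i < r \<longrightarrow> (\<forall>l. Z i l \<in> pw (K - \<rho>)) \<and>
      (\<forall>i'<r. ?J i' (Z i) - (if i' = i then - eval_mpoly y (f i) else 0) \<in> pw (Suc K))"
    using solve[OF pw_uminus[OF fy]] by (intro choice) blast
  then obtain Z where Z: "\<And>i l. i < r \<Longrightarrow> Z i l \<in> pw (K - \<rho>)"
    and J: "\<And>i i'. i < r \<Longrightarrow> i' < r \<Longrightarrow>
      ?J i' (Z i) - (if i' = i then - eval_mpoly y (f i) else 0) \<in> pw (Suc K)"
    by blast
  define z where "z l = (\<Sum>i<r. Z i l)" for l
  have z: "z l \<in> pw (K - \<rho>)" for l
    unfolding z_def using Z by (intro pw_sum) auto
  moreover have "eval_mpoly (\<lambda>l. y l + z l) (f i) \<in> pw (Suc K)" if i: "i < r" for i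
  proof -
    have "?J i z = (\<Sum>i'<r. ?J i (Z i'))"
      unfolding z_def sum_distrib_left by (rule sum.swap)
    then have "?J i z + eval_mpoly y (f i) =
        (\<Sum>i'<r. ?J i (Z i') - (if i = i' then - eval_mpoly y (f i') else 0))"
      using i by (simp add: sum_subtractf)
    also have "\<dots> \<in> pw (Suc K)"
      using J i by (intro pw_sum) auto
    finally have linear: "?J i z + eval_mpoly y (f i) \<in> pw (Suc K)" .
    have "eval_mpoly (\<lambda>l. y l + z l) (f i) - eval_mpoly y (f i) - ?J i z
        \<in> pw ((K - \<rho>) + (K - \<rho>))"
      by (intro taylor_mod z f i)
    then have "eval_mpoly (\<lambda>l. y l + z l) (f i) - eval_mpoly y (f i) - ?J i z \<in> pw (Suc K)"
      by (rule pw_antimonoD) (use K in linarith)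
    from pw_plus[OF this linear] show ?thesis by simp
  qed
  ultimately show ?thesis using that by blast
qed

text \<open>All iterates stay congruent to \<open>y\<close> modulo \<open>\<mm>\<^bsup>K - \<rho>\<^esup> \<subseteq> \<mm>\<^bsup>\<rho> + 1\<^esup>\<close>, so the values of \<open>H\<close> keep filling
  \<open>\<mm>\<^sup>\<rho>\<close> and Newton's step can be repeated with the same \<open>\<rho>\<close>.\<close>

lemma newton_iteration:
  assumes f: "\<And>i. i < r \<Longrightarrow> f i \<in> carrier (mpoly_ring n)"
    and H: "ideal H (mpoly_ring n)" "H \<subseteq> jacobian_ideal n r f"
    and fill: "values_fill_pw H \<rho> y"
    and K: "2 * \<rho> + 1 \<le> K" and fy: "\<And>i. i < r \<Longrightarrow> eval_mpoly y (f i) \<in> pw K"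
  obtains Y where "\<And>k i. i < r \<Longrightarrow> eval_mpoly (Y k) (f i) \<in> pw (K + k)"
    and "\<And>k l. Y (Suc k) l - Y k l \<in> pw (K + k - \<rho>)"
    and "\<And>k l. Y k l - y l \<in> pw (K - \<rho>)"
    and "\<And>k. values_fill_pw H \<rho> (Y k)"
proof -
  have H_carrier: "H \<subseteq> carrier (mpoly_ring n)"
    using H(1) by (meson additive_subgroup.a_subset ideal.axioms(1))
  have fill': "values_fill_pw H \<rho> x" if "\<And>l. x l - y l \<in> pw (K - \<rho>)" for x
    using fill H_carrier
    by (rule values_fill_pw_cong) (rule pw_antimonoD[OF that], use K in linarith)
  let ?P = "\<lambda>k x. (\<forall>i<r. eval_mpoly x (f i) \<in> pw (K + k)) \<and> (\<forall>l. x l - y l \<in> pw (K - \<rho>))"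
  let ?Q = "\<lambda>k x x'. \<forall>l. x' l - x l \<in> pw (K + k - \<rho>)"
  have "\<exists>Y. \<forall>k. ?P k (Y k) \<and> ?Q k (Y k) (Y (Suc k))"
  proof (rule dependent_nat_choice)
    show "\<exists>x. ?P 0 x" using fy by (intro exI[of _ y]) (auto simp: pw_zero)
  next
    fix x k assume x: "?P k x"
    have K': "2 * \<rho> + 1 \<le> K + k" using K by simp
    have fillx: "values_fill_pw H \<rho> x" using x by (intro fill') auto
    obtain z where z: "\<And>l. z l \<in> pw (K + k - \<rho>)"
      "\<And>i. i < r \<Longrightarrow> eval_mpoly (\<lambda>l. x l + z l) (f i) \<in> pw (Suc (K + k))"
      using newton_step[of r f n H \<rho> x "K + k", OF f H(2) fillx K'] x by blast
    have "(x l - y l) + z l \<in> pw (K - \<rho>)" for l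
      using x pw_antimonoD[OF z(1), of "K - \<rho>"] by (intro pw_plus) auto
    then show "\<exists>x'. ?P (Suc k) x' \<and> ?Q k x x'"
      using z by (intro exI[of _ "\<lambda>l. x l + z l"]) (auto simp: algebra_simps)
  qed
  then obtain Y where Y: "\<And>k. ?P k (Y k) \<and> ?Q k (Y k) (Y (Suc k))" by blast
  show ?thesis
    using Y fill' by (intro that[of Y]) blast+
qed

text \<open>Approximate \<open>a\<close> by \<open>h(y)\<close> up to \<open>\<mm>\<^sup>K\<close>; then \<open>h(y) g(y)\<close> is the value of an element of \<open>(f)\<close>.\<close>

lemma values_annihilated:
  assumes fill: "values_fill_pw H \<rho> y" and H: "ideal H (mpoly_ring n)"
    and f: "\<And>i. i < r \<Longrightarrow> f i \<in> carrier (mpoly_ring n)"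
    and Hg: "\<And>h. h \<in> H \<Longrightarrow> h * g \<in> genideal (mpoly_ring n) (f ` {..<r})"
    and fy: "\<And>i. i < r \<Longrightarrow> eval_mpoly y (f i) \<in> pw K"
    and a: "a \<in> pw \<rho>"
  shows "a * eval_mpoly y g \<in> pw K"
proof -
  obtain h where h: "h \<in> H" "a - eval_mpoly y h \<in> pw (\<rho> + K)"
    using values_fill_pw_iterate[OF fill H a] by blast
  have "eval_mpoly y (h * g) \<in> pw K"
    using Hg[OF h(1)] by (rule eval_mpoly_genideal) (use f fy ideal_pw in auto)
  moreover have "(a - eval_mpoly y h) * eval_mpoly y g \<in> pw K"
    using pw_antimonoD[OF h(2), of K] by (intro pw_mult_right) simp
  ultimately have "(a - eval_mpoly y h) * eval_mpoly y g + eval_mpoly y (h * g) \<in> pw K"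
    by (rule pw_plus[rotated])
  then show ?thesis by (simp add: eval_mpoly_mult algebra_simps)
qed

text \<open>The Newton sequence for \<open>f\<close> is also an approximate zero of all of \<open>I\<close>. For a given precision \<open>k\<close>
  this is seen at a later member \<open>Y\<^sub>j\<close> of the sequence, where \<open>\<mm>\<^sup>\<rho> g(Y\<^sub>j)\<close> is already as small as
  the colon hypothesis demands, and then carried back to \<open>Y\<^sub>k\<close>.\<close>

lemma newton_limit:
  assumes H: "ideal H (mpoly_ring n)" "H \<subseteq> jacobian_ideal n r f"
    and HI: "\<And>h g. h \<in> H \<Longrightarrow> g \<in> I \<Longrightarrow> h * g \<in> genideal (mpoly_ring n) (f ` {..<r})"
    and I: "I \<subseteq> carrier (mpoly_ring n)" and f: "\<And>i. i < r \<Longrightarrow> f i \<in> I"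
    and fill: "values_fill_pw H \<rho> y" and y: "\<And>g. g \<in> I \<Longrightarrow> eval_mpoly y g \<in> pw N"
    and N: "2 * \<rho> + 1 \<le> N" "e + \<rho> \<le> N"
    and colon: "\<And>M. \<exists>K. \<forall>a\<in>pw e. (\<forall>b\<in>pw \<rho>. b * a \<in> pw K) \<longrightarrow> a \<in> pw M"
  obtains Y where "\<And>l. \<forall>k. Y (Suc k) l - Y k l \<in> pw k"
    and "\<And>k l. Y k l - y l \<in> pw (N - \<rho>)"
    and "\<And>k g. g \<in> I \<Longrightarrow> eval_mpoly (Y k) g \<in> pw k"
proof -
  have f': "f i \<in> carrier (mpoly_ring n)" if "i < r" for i using f[OF that] I by blast
  obtain Y where Yf: "\<And>k i. i < r \<Longrightarrow> eval_mpoly (Y k) (f i) \<in> pw (N + k)"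
    and Y_Suc: "\<And>k l. Y (Suc k) l - Y k l \<in> pw (N + k - \<rho>)"
    and Y_y: "\<And>k l. Y k l - y l \<in> pw (N - \<rho>)"
    and Y_fill: "\<And>k. values_fill_pw H \<rho> (Y k)"
    using newton_iteration[of r f n H \<rho> y N, OF f' H fill N(1) y[OF f]] by blast
  have step: "Y (Suc k) l - Y k l \<in> pw k" for k l
    by (rule pw_antimonoD[OF Y_Suc]) (use N in linarith)
  have diff: "Y (k + j) l - Y k l \<in> pw k" for k j l
  proof (induction j)
    case 0
    show ?case by (simp add: pw_zero)
  next
    case (Suc j)
    from pw_plus[OF this pw_antimonoD[OF step[of "k + j" l], of k]] show ?case by simp
  qed
  have "eval_mpoly (Y k) g \<in> pw k" if g: "g \<in> I" for k g
  proof -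
    obtain K where K: "\<And>a. a \<in> pw e \<Longrightarrow> (\<And>b. b \<in> pw \<rho> \<Longrightarrow> b * a \<in> pw K) \<Longrightarrow> a \<in> pw k"
      using colon[of k] by blast
    have gP: "g \<in> carrier (mpoly_ring n)" using g I by blast
    \<comment> \<open>At least \<open>K\<close>, to apply the colon hypothesis, and at least \<open>k\<close>, to compare \<open>Y\<^sub>j\<close> with \<open>Y\<^sub>k\<close>.\<close>
    define j where "j = k + K"
    have "eval_mpoly (Y j) g - eval_mpoly y g \<in> pw (N - \<rho>)"
      using Y_y gP by (intro eval_mpoly_cong_mod[OF ideal_pw]) auto
    then have "eval_mpoly (Y j) g - eval_mpoly y g \<in> pw e"
      by (rule pw_antimonoD) (use N in linarith)
    from pw_plus[OF this pw_antimonoD[OF y[OF g], of e]] have "eval_mpoly (Y j) g \<in> pw e"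
      using N by simp
    moreover have "b * eval_mpoly (Y j) g \<in> pw K" if b: "b \<in> pw \<rho>" for b
    proof -
      have "b * eval_mpoly (Y j) g \<in> pw (N + j)"
        using Y_fill H(1) f' HI[OF _ g] Yf b by (rule values_annihilated)
      then show ?thesis by (rule pw_antimonoD) (simp add: j_def)
    qed
    ultimately have Yj: "eval_mpoly (Y j) g \<in> pw k" by (rule K)
    have "eval_mpoly (Y j) g - eval_mpoly (Y k) g \<in> pw k"
      using diff[of k K] gP by (intro eval_mpoly_cong_mod[OF ideal_pw]) (auto simp: j_def)
    from pw_minus[OF Yj this] show ?thesis by simp
  qed
  with step Y_y that show ?thesis by blast
qed

end

section \<open>The completion\<close>

lemma set_add_eq_coset:
  fixes R :: "('a, 'b) ring_scheme"
  assumes "U \<noteq> {}" "\<And>x'. x' \<in> U \<Longrightarrow> J +>\<^bsub>R\<^esub> x' = J +>\<^bsub>R\<^esub> x"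
  shows "set_add R J U = J +>\<^bsub>R\<^esub> x"
proof -
  have "set_add R J U = (\<Union>x'\<in>U. J +>\<^bsub>R\<^esub> x')"
    by (auto simp: set_add_def' a_r_coset_def')
  then show ?thesis using assms by auto
qed

context ideal_adic
begin

text \<open>Elements of the completion are represented by sequences in \<open>A\<close> with \<open>u\<^bsub>k+1\<^esub> \<equiv> u\<^sub>k\<close> modulo \<open>\<mm>\<^sup>k\<close>,
  so that the ring operations are those of functions.\<close>

definition coherent :: "(nat \<Rightarrow> 'a) \<Rightarrow> bool" where
  "coherent u \<longleftrightarrow> (\<forall>k. u (Suc k) - u k \<in> pw k)"

definition adic_limit :: "(nat \<Rightarrow> 'a) \<Rightarrow> nat \<Rightarrow> 'a set" where
  "adic_limit u = (\<lambda>k. pw k +>\<^bsub>type_ring\<^esub> u k)"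

lemma completion_map_eq: "completion_map type_ring \<mm> a = adic_limit (\<lambda>_. a)"
  by (simp add: completion_map_def adic_limit_def pw_def)

lemma coherent_const: "coherent (\<lambda>_. a)"
  by (simp add: coherent_def pw_zero)

lemma coherent_add: "coherent u \<Longrightarrow> coherent w \<Longrightarrow> coherent (\<lambda>k. u k + w k)"
  unfolding coherent_def by (simp add: pw_plus add_diff_add)

lemma coherent_mult:
  assumes "coherent u" "coherent w"
  shows "coherent (\<lambda>k. u k * w k)"
  unfolding coherent_def
proof
  fix k
  have "u (Suc k) * (w (Suc k) - w k) + w k * (u (Suc k) - u k) \<in> pw k"
    using assms by (auto simp: coherent_def intro!: pw_plus pw_mult_left)
  then show "u (Suc k) * w (Suc k) - u k * w k \<in> pw k" by (simp add: algebra_simps)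
qed

lemma coherent_uminus: "coherent u \<Longrightarrow> coherent (\<lambda>k. - u k)"
  using coherent_mult[OF coherent_const[of "-1"]] by simp

lemma coherent_diff_mem:
  assumes "coherent u" shows "u (k + j) - u k \<in> pw k"
proof (induction j)
  case 0
  show ?case by (simp add: pw_zero)
next
  case (Suc j)
  have "u (Suc (k + j)) - u (k + j) \<in> pw k"
    using assms pw_antimonoD[of "u (Suc (k + j)) - u (k + j)" "k + j" k] by (simp add: coherent_def)
  from pw_plus[OF Suc this] show ?case by simp
qed

lemma adic_limit_eq_iff: "adic_limit u = adic_limit w \<longleftrightarrow> (\<forall>k. u k - w k \<in> pw k)"
  by (auto simp: adic_limit_def fun_eq_iff coset_eq_iff[OF ideal_pw])

lemma induced_map_coset:
  "induced_map type_ring (pw k) (\<lambda>a. a) (pw (Suc k) +>\<^bsub>type_ring\<^esub> a) = pw k +>\<^bsub>type_ring\<^esub> a"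
  unfolding induced_map_def
proof (rule set_add_eq_coset)
  show "(\<lambda>a. a) ` (pw (Suc k) +>\<^bsub>type_ring\<^esub> a) \<noteq> {}"
    using pw_zero by (auto simp: coset_eq[OF ideal_pw] intro!: exI[of _ a])
next
  fix b assume "b \<in> (\<lambda>a. a) ` (pw (Suc k) +>\<^bsub>type_ring\<^esub> a)"
  then have "b - a \<in> pw (Suc k)" by (simp add: coset_eq[OF ideal_pw])
  then show "pw k +>\<^bsub>type_ring\<^esub> b = pw k +>\<^bsub>type_ring\<^esub> a"
    using pw_Suc_subset by (auto simp: coset_eq_iff[OF ideal_pw])
qed

lemma mem_completion_iff:
  "x \<in> carrier (completion type_ring \<mm>) \<longleftrightarrow>
    (\<forall>k. x k \<in> carrier (type_ring Quot pw k)) \<and>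
    (\<forall>k. x k = induced_map type_ring (pw k) (\<lambda>a. a) (x (Suc k)))"
  unfolding completion_def pw_def by (simp only: partial_object.select_convs mem_Collect_eq)

lemma carrier_completion:
  "carrier (completion type_ring \<mm>) = adic_limit ` {u. coherent u}"
proof (intro equalityI subsetI)
  fix x assume "x \<in> carrier (completion type_ring \<mm>)"
  then have x: "\<And>k. x k \<in> carrier (type_ring Quot pw k)"
    "\<And>k. x k = induced_map type_ring (pw k) (\<lambda>a. a) (x (Suc k))"
    unfolding mem_completion_iff by blast+
  have "\<exists>u. \<forall>k. x k = pw k +>\<^bsub>type_ring\<^esub> u k"
    using x(1) unfolding carrier_type_Quot[OF ideal_pw] by (intro choice) blast
  then obtain u where u: "\<And>k. x k = pw k +>\<^bsub>type_ring\<^esub> u k" by blast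
  have "pw k +>\<^bsub>type_ring\<^esub> u k = pw k +>\<^bsub>type_ring\<^esub> u (Suc k)" for k
    using x(2)[of k] unfolding u induced_map_coset .
  then have "u k - u (Suc k) \<in> pw k" for k
    by (simp add: coset_eq_iff[OF ideal_pw])
  then have "coherent u"
    unfolding coherent_def using pw_uminus by fastforce
  moreover have "x = adic_limit u" by (simp add: adic_limit_def u fun_eq_iff)
  ultimately show "x \<in> adic_limit ` {u. coherent u}" by blast
next
  fix x assume "x \<in> adic_limit ` {u. coherent u}"
  then obtain u where u: "coherent u" "x = adic_limit u" by blast
  have "pw k +>\<^bsub>type_ring\<^esub> u k = pw k +>\<^bsub>type_ring\<^esub> u (Suc k)" for k
    using u(1) pw_uminus[of "u (Suc k) - u k" k] by (simp add: coset_eq_iff[OF ideal_pw] coherent_def)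
  then have "\<forall>k. x k = induced_map type_ring (pw k) (\<lambda>a. a) (x (Suc k))"
    unfolding u(2) adic_limit_def induced_map_coset by blast
  moreover have "\<forall>k. x k \<in> carrier (type_ring Quot pw k)"
    by (simp add: u(2) adic_limit_def carrier_type_Quot[OF ideal_pw])
  ultimately show "x \<in> carrier (completion type_ring \<mm>)"
    unfolding mem_completion_iff by blast
qed

lemma completionE:
  assumes "x \<in> carrier (completion type_ring \<mm>)"
  obtains u where "coherent u" "x = adic_limit u"
  using assms unfolding carrier_completion by blast

lemma adic_limit_carrier: "coherent u \<Longrightarrow> adic_limit u \<in> carrier (completion type_ring \<mm>)"
  unfolding carrier_completion by blast

lemma completion_mult:
  "adic_limit u \<otimes>\<^bsub>completion type_ring \<mm>\<^esub> adic_limit w = adic_limit (\<lambda>k. u k * w k)"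
  using coset_mult[OF ideal_pw] by (simp add: completion_def adic_limit_def pw_def)

lemma completion_add:
  "adic_limit u \<oplus>\<^bsub>completion type_ring \<mm>\<^esub> adic_limit w = adic_limit (\<lambda>k. u k + w k)"
  using coset_add[OF ideal_pw] by (simp add: completion_def adic_limit_def pw_def)

lemma completion_one: "\<one>\<^bsub>completion type_ring \<mm>\<^esub> = adic_limit (\<lambda>_. 1)"
  using coset_one[OF ideal_pw] by (simp add: completion_def adic_limit_def pw_def)

lemma completion_zero: "\<zero>\<^bsub>completion type_ring \<mm>\<^esub> = adic_limit (\<lambda>_. 0)"
  using coset_zero[OF ideal_pw] by (simp add: completion_def adic_limit_def pw_def)

lemma completion_ring: "ring (completion type_ring \<mm>)"
proof (rule ringI)
  show "abelian_group (completion type_ring \<mm>)"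
  proof (rule abelian_groupI)
    fix x assume "x \<in> carrier (completion type_ring \<mm>)"
    then obtain u where u: "coherent u" "x = adic_limit u" by (rule completionE)
    then show "\<exists>y\<in>carrier (completion type_ring \<mm>).
        y \<oplus>\<^bsub>completion type_ring \<mm>\<^esub> x = \<zero>\<^bsub>completion type_ring \<mm>\<^esub>"
      using adic_limit_carrier[OF coherent_uminus[OF u(1)]]
      by (intro bexI[of _ "adic_limit (\<lambda>k. - u k)"]) (simp_all add: completion_add completion_zero)
  qed (auto elim!: completionE intro!: adic_limit_carrier coherent_add coherent_const
      simp: completion_add completion_zero ac_simps)
  show "monoid (completion type_ring \<mm>)"
    by (rule monoidI) (auto elim!: completionE intro!: adic_limit_carrier coherent_mult coherent_const
      simp: completion_mult completion_one ac_simps)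
qed (auto elim!: completionE simp: completion_mult completion_add algebra_simps)

lemma completion_minus:
  assumes "coherent u" "coherent w"
  shows "adic_limit u \<ominus>\<^bsub>completion type_ring \<mm>\<^esub> adic_limit w = adic_limit (\<lambda>k. u k - w k)"
proof -
  interpret ring "completion type_ring \<mm>" by (rule completion_ring)
  have "\<ominus>\<^bsub>completion type_ring \<mm>\<^esub> adic_limit w = adic_limit (\<lambda>k. - w k)"
    using assms adic_limit_carrier coherent_uminus
    by (intro minus_equality) (simp_all add: completion_add completion_zero)
  then show ?thesis by (simp add: a_minus_def completion_add)
qed

text \<open>If \<open>G\<close> generates \<open>\<mm>\<^sup>c\<close>, elements of \<open>\<mm>\<^bsup>k + c\<^esup> = \<mm>\<^sup>k \<mm>\<^sup>c\<close> are combinations of \<open>G\<close> with coefficients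
  in \<open>\<mm>\<^sup>k\<close>. The smallness of the coefficients makes series of such combinations converge.\<close>

lemma pw_add_coefficients:
  assumes G: "finite G" "pw c = genideal type_ring G" and x: "x \<in> pw (k + c)"
  shows "\<exists>b. (\<forall>g. b g \<in> pw k) \<and> x = (\<Sum>g\<in>G. b g * g)"
  using x
proof (induction rule: pw_add_induct)
  case (mult a b)
  define T where "T = {x. \<exists>b. x = (\<Sum>g\<in>G. b g * g)}"
  have "ideal T type_ring"
    unfolding ideal_type_ring_iff
  proof (intro conjI ballI allI)
    show "0 \<in> T" by (auto simp: T_def intro!: exI[of _ "\<lambda>_. 0"])
  next
    fix x x' assume "x \<in> T" "x' \<in> T"
    then obtain b b' where "x = (\<Sum>g\<in>G. b g * g)" "x' = (\<Sum>g\<in>G. b' g * g)" by (auto simp: T_def)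
    then show "x + x' \<in> T"
      by (auto simp: T_def distrib_right sum.distrib intro!: exI[of _ "\<lambda>g. b g + b' g"])
  next
    fix a x assume "x \<in> T"
    then obtain b where "x = (\<Sum>g\<in>G. b g * g)" by (auto simp: T_def)
    then show "a * x \<in> T"
      by (auto simp: T_def sum_distrib_left mult.assoc intro!: exI[of _ "\<lambda>g. a * b g"])
  qed
  moreover have "G \<subseteq> T"
  proof
    fix g assume "g \<in> G"
    then have "g = (\<Sum>g'\<in>G. (if g' = g then 1 else 0) * g')"
      using G(1) by (simp add: if_distrib[of "\<lambda>x. x * _"] cong: if_cong)
    then show "g \<in> T"
      unfolding T_def by (intro CollectI exI[of _ "\<lambda>g'. if g' = g then 1 else 0"])
  qed
  ultimately have "pw c \<subseteq> T"
    unfolding G(2) by (rule ring.genideal_minimal[OF type_ring_ring])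
  with mult obtain d where "b = (\<Sum>g\<in>G. d g * g)" by (auto simp: T_def)
  then show ?case
    using mult by (intro exI[of _ "\<lambda>g. a * d g"])
      (auto simp: sum_distrib_left mult.assoc intro: pw_mult_right)
next
  case (add x x')
  then obtain b b' where "\<forall>g. b g \<in> pw k" "x = (\<Sum>g\<in>G. b g * g)"
    "\<forall>g. b' g \<in> pw k" "x' = (\<Sum>g\<in>G. b' g * g)" by blast
  then show ?case
    by (intro exI[of _ "\<lambda>g. b g + b' g"]) (auto simp: distrib_right sum.distrib intro: pw_plus)
qed

text \<open>Write \<open>u\<close> as a series with terms in \<open>\<mm>\<^bsup>k + c\<^esup>\<close>, expand each term in a finite system of generators
  of \<open>\<mm>\<^sup>c\<close>, and sum the coefficients of each generator separately.\<close>

lemma adic_limit_mem_extended_pw: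
  assumes noeth: "noetherian_ring (type_ring :: 'a ring)"
    and u: "coherent u" "\<And>k. u k \<in> pw c"
    and J: "ideal J (completion type_ring \<mm>)" "completion_map type_ring \<mm> ` pw c \<subseteq> J"
  shows "adic_limit u \<in> J"
proof -
  obtain G where G: "finite G" "pw c = genideal type_ring G"
    using noetherian_ring.finetely_gen[OF noeth ideal_pw[of c]] by blast
  then have G_pw: "G \<subseteq> pw c"
    using ring.genideal_self[OF type_ring_ring, of G] by simp
  \<comment> \<open>The shift by \<open>c\<close> puts the increment \<open>d (k + 1)\<close> into \<open>\<mm>\<^bsup>k + c\<^esup>\<close>; the initial term is only in \<open>\<mm>\<^sup>c\<close>.\<close>
  define d where "d k = (if k = 0 then u c else u (k + c) - u (k + c - 1))" for k
  \<comment> \<open>For \<open>k = 0\<close> the truncated exponent \<open>k - 1\<close> puts no condition on the coefficients.\<close>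
  have "\<exists>b. (\<forall>g. b g \<in> pw (k - 1)) \<and> d k = (\<Sum>g\<in>G. b g * g)" for k
  proof (rule pw_add_coefficients[OF G])
    show "d k \<in> pw (k - 1 + c)"
      using u by (cases k) (auto simp: d_def coherent_def)
  qed
  then obtain b where b: "\<And>k g. b k g \<in> pw (k - 1)" "\<And>k. d k = (\<Sum>g\<in>G. b k g * g)"
    by metis
  define B where "B g k = (\<Sum>i\<le>k. b i g)" for g k
  have B: "coherent (B g)" for g
    unfolding coherent_def B_def using b(1)[of "Suc _" g] by simp
  have "(\<Sum>g\<in>G. B g k * g) = u (k + c)" for k
  proof -
    have "(\<Sum>g\<in>G. B g k * g) = (\<Sum>i\<le>k. d i)"
      unfolding B_def b(2) sum_distrib_right by (rule sum.swap)
    also have "\<dots> = u (k + c)"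
      by (induction k) (simp_all add: d_def)
    finally show ?thesis .
  qed
  then have eq: "adic_limit (\<lambda>k. \<Sum>g\<in>G. B g k * g) = adic_limit u"
    using coherent_diff_mem[OF u(1)] by (simp add: adic_limit_eq_iff)
  have "adic_limit (\<lambda>k. \<Sum>g\<in>T. B g k * g) \<in> J" if "finite T" "T \<subseteq> G" for T
    using that
  proof (induction T)
    case empty
    show ?case
      using additive_subgroup.zero_closed[OF ideal.axioms(1)[OF J(1)]]
      by (simp add: completion_zero)
  next
    case (insert g T)
    have "adic_limit (\<lambda>_. g) \<in> J"
      using J(2) G_pw insert.prems by (auto simp: completion_map_eq)
    then have "adic_limit (B g) \<otimes>\<^bsub>completion type_ring \<mm>\<^esub> adic_limit (\<lambda>_. g) \<in> J"
      using B by (intro ideal.I_l_closed[OF J(1)]) (auto intro: adic_limit_carrier)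
    with insert have "adic_limit (\<lambda>k. B g k * g) \<oplus>\<^bsub>completion type_ring \<mm>\<^esub>
        adic_limit (\<lambda>k. \<Sum>g\<in>T. B g k * g) \<in> J"
      by (intro additive_subgroup.a_closed[OF ideal.axioms(1)[OF J(1)]]) (auto simp: completion_mult)
    then show ?case using insert.hyps by (simp add: completion_add)
  qed
  from this[OF G(1) subset_refl] show ?thesis unfolding eq .
qed

text \<open>Both sides are the class of \<open>a\<close>: the right-hand side because \<open>\<mm>\<^sup>N \<subseteq> \<mm>\<^sup>c\<close>, the left-hand side because
  the limit of \<open>u - a\<close> lies in the extension of \<open>\<mm>\<^sup>c\<close>.\<close>

lemma coset_adic_limit_eq:
  assumes noeth: "noetherian_ring (type_ring :: 'a ring)" and "c \<le> N"
    and u: "coherent u" "\<And>k. u k - a \<in> pw c"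
  defines "J \<equiv> genideal (completion type_ring \<mm>) (completion_map type_ring \<mm> ` pw c)"
  shows "J +>\<^bsub>completion type_ring \<mm>\<^esub> adic_limit u =
    induced_map (completion type_ring \<mm>) J (completion_map type_ring \<mm>) (pw N +>\<^bsub>type_ring\<^esub> a)"
proof -
  interpret hat: ring "completion type_ring \<mm>" by (rule completion_ring)
  have sub: "completion_map type_ring \<mm> ` pw c \<subseteq> carrier (completion type_ring \<mm>)"
    by (auto simp: completion_map_eq intro: adic_limit_carrier coherent_const)
  have J: "ideal J (completion type_ring \<mm>)"
    unfolding J_def by (rule hat.genideal_ideal[OF sub])
  have J_sup: "completion_map type_ring \<mm> ` pw c \<subseteq> J"
    unfolding J_def by (rule hat.genideal_self[OF sub])
  have eq: "J +>\<^bsub>completion type_ring \<mm>\<^esub> completion_map type_ring \<mm> b =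
      J +>\<^bsub>completion type_ring \<mm>\<^esub> adic_limit u" if b: "b - a \<in> pw c" for b
  proof -
    have "b - u k \<in> pw c" for k
      using pw_minus[OF b u(2)[of k]] by simp
    then have "adic_limit (\<lambda>k. b - u k) \<in> J"
      using coherent_add[OF coherent_const coherent_uminus[OF u(1)], of b]
      by (intro adic_limit_mem_extended_pw[OF noeth _ _ J J_sup]) simp_all
    then have "completion_map type_ring \<mm> b \<ominus>\<^bsub>completion type_ring \<mm>\<^esub> adic_limit u \<in> J"
      by (simp add: completion_map_eq completion_minus coherent_const u(1))
    then show ?thesis
      using hat.quotient_eq_iff_same_a_r_cos[OF J] adic_limit_carrier[OF u(1)]
        adic_limit_carrier[OF coherent_const, of b] by (simp add: completion_map_eq)
  qed
  show ?thesis
    unfolding induced_map_def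
  proof (rule set_add_eq_coset[symmetric])
    show "completion_map type_ring \<mm> ` (pw N +>\<^bsub>type_ring\<^esub> a) \<noteq> {}"
      using pw_zero by (auto simp: coset_eq[OF ideal_pw] intro!: exI[of _ a])
  next
    fix x assume "x \<in> completion_map type_ring \<mm> ` (pw N +>\<^bsub>type_ring\<^esub> a)"
    then obtain b where "x = completion_map type_ring \<mm> b" "b - a \<in> pw N"
      by (auto simp: coset_eq[OF ideal_pw])
    then show "J +>\<^bsub>completion type_ring \<mm>\<^esub> x = J +>\<^bsub>completion type_ring \<mm>\<^esub> adic_limit u"
      using eq[of b] pw_antimonoD[of "b - a" N c] \<open>c \<le> N\<close> by simp
  qed
qed

end

section \<open>Morphisms from a finitely generated algebra\<close>

lemma (in cring) ideal_quotient_ideal: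
  assumes J: "ideal J R" and I: "I \<subseteq> carrier R"
  shows "ideal (ideal_quotient R J I) R"
proof -
  interpret J: ideal J R by (rule J)
  have sub: "subgroup (ideal_quotient R J I) (add_monoid R)"
  proof (rule group.subgroupI[OF a_group])
    show "ideal_quotient R J I \<noteq> {}"
      using I J.zero_closed by (auto simp: ideal_quotient_def subset_iff intro!: exI[of _ \<zero>])
  next
    fix a assume "a \<in> ideal_quotient R J I"
    then show "inv\<^bsub>add_monoid R\<^esub> a \<in> ideal_quotient R J I"
      using I by (auto simp: ideal_quotient_def subset_iff l_minus a_inv_def[symmetric])
  qed (use I in \<open>auto simp: ideal_quotient_def subset_iff l_distr\<close>)
  show ?thesis
  proof (rule idealI[OF ring_axioms sub])
    fix a x assume "a \<in> ideal_quotient R J I" "x \<in> carrier R"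
    then show "x \<otimes> a \<in> ideal_quotient R J I"
      using I by (auto simp: ideal_quotient_def subset_iff m_assoc J.I_l_closed)
    then show "a \<otimes> x \<in> ideal_quotient R J I"
      using \<open>a \<in> _\<close> \<open>x \<in> _\<close> by (simp add: ideal_quotient_def m_comm)
  qed
qed

context ideal_adic
begin

text \<open>The value does not depend on the representative \<open>p\<close> of the class \<open>U\<close> when the polynomials in the
  ideal vanish in the limit; see \<open>limit_hom_coset\<close>.\<close>

definition limit_hom :: "(nat \<Rightarrow> nat \<Rightarrow> 'a) \<Rightarrow> 'a mpoly set \<Rightarrow> nat \<Rightarrow> 'a set" where
  "limit_hom Y U = adic_limit (\<lambda>k. eval_mpoly (Y k) (SOME p. p \<in> U))"

context
  fixes n :: nat and I :: "'a mpoly set" and Y :: "nat \<Rightarrow> nat \<Rightarrow> 'a"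
  assumes I: "ideal I (mpoly_ring n)"
    and Y: "\<And>l. coherent (\<lambda>k. Y k l)"
    and zero: "\<And>k g. g \<in> I \<Longrightarrow> eval_mpoly (Y k) g \<in> pw k"
begin

lemma coherent_eval: "p \<in> carrier (mpoly_ring n) \<Longrightarrow> coherent (\<lambda>k. eval_mpoly (Y k) p)"
  unfolding coherent_def
  using Y by (auto intro!: eval_mpoly_cong_mod[OF ideal_pw, where n = n] simp: coherent_def)

lemma limit_hom_coset:
  "limit_hom Y (I +>\<^bsub>mpoly_ring n\<^esub> p) = adic_limit (\<lambda>k. eval_mpoly (Y k) p)"
proof -
  let ?U = "I +>\<^bsub>mpoly_ring n\<^esub> p"
  have "0 \<in> I" using additive_subgroup.zero_closed[OF ideal.axioms(1)[OF I]] by simp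
  then have "p \<in> ?U" by (auto simp: a_r_coset_def' intro!: bexI[of _ 0])
  then have "(SOME q. q \<in> ?U) \<in> ?U" by (rule someI)
  then obtain h where h: "h \<in> I" "(SOME q. q \<in> ?U) = h + p" by (auto simp: a_r_coset_def')
  then show ?thesis
    using zero[OF h(1)] by (simp add: limit_hom_def adic_limit_eq_iff eval_mpoly_add)
qed

lemma limit_hom_in_ring_hom:
  "limit_hom Y \<in> Ring.ring_hom (mpoly_ring n Quot I) (completion type_ring \<mm>)"
proof -
  have carrierE: "\<exists>p\<in>carrier (mpoly_ring n). U = I +>\<^bsub>mpoly_ring n\<^esub> p"
    if "U \<in> carrier (mpoly_ring n Quot I)" for U
    using that by (auto simp: FactRing_def A_RCOSETS_def' a_r_coset_def')
  show ?thesis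
  proof (rule ring_hom_memI)
    fix U assume "U \<in> carrier (mpoly_ring n Quot I)"
    then obtain p where p: "p \<in> carrier (mpoly_ring n)" "U = I +>\<^bsub>mpoly_ring n\<^esub> p"
      using carrierE by blast
    then show "limit_hom Y U \<in> carrier (completion type_ring \<mm>)"
      by (simp add: limit_hom_coset adic_limit_carrier coherent_eval)
    fix V assume "V \<in> carrier (mpoly_ring n Quot I)"
    then obtain q where q: "q \<in> carrier (mpoly_ring n)" "V = I +>\<^bsub>mpoly_ring n\<^esub> q"
      using carrierE by blast
    have "U \<otimes>\<^bsub>mpoly_ring n Quot I\<^esub> V = I +>\<^bsub>mpoly_ring n\<^esub> (p * q)"
      using ideal.rcoset_mult_add[OF I p(1) q(1)] by (simp add: p q FactRing_def)
    then show "limit_hom Y (U \<otimes>\<^bsub>mpoly_ring n Quot I\<^esub> V) =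
        limit_hom Y U \<otimes>\<^bsub>completion type_ring \<mm>\<^esub> limit_hom Y V"
      by (simp add: p q limit_hom_coset completion_mult eval_mpoly_mult)
    have "U \<oplus>\<^bsub>mpoly_ring n Quot I\<^esub> V = I +>\<^bsub>mpoly_ring n\<^esub> (p + q)"
      using ideal.a_rcos_sum[OF I p(1) q(1)] by (simp add: p q FactRing_def)
    then show "limit_hom Y (U \<oplus>\<^bsub>mpoly_ring n Quot I\<^esub> V) =
        limit_hom Y U \<oplus>\<^bsub>completion type_ring \<mm>\<^esub> limit_hom Y V"
      by (simp add: p q limit_hom_coset completion_add eval_mpoly_add)
  next
    have "\<one>\<^bsub>mpoly_ring n Quot I\<^esub> = I +>\<^bsub>mpoly_ring n\<^esub> 1" by (simp add: FactRing_def)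
    then show "limit_hom Y \<one>\<^bsub>mpoly_ring n Quot I\<^esub> = \<one>\<^bsub>completion type_ring \<mm>\<^esub>"
      by (simp add: limit_hom_coset completion_one)
  qed
qed

end

lemma alg_hom_eq_eval:
  assumes I: "ideal I (mpoly_ring n)" and S: "ideal S (type_ring :: 'a ring)"
    and v: "v \<in> alg_hom type_ring (mpoly_ring n Quot I) (\<lambda>a. I +>\<^bsub>mpoly_ring n\<^esub> mpoly_const a)
      (type_ring Quot S) (\<lambda>a. S +>\<^bsub>type_ring\<^esub> a)"
    and y: "\<And>i. i < n \<Longrightarrow> v (I +>\<^bsub>mpoly_ring n\<^esub> mpoly_var i) = S +>\<^bsub>type_ring\<^esub> y i"
    and p: "p \<in> carrier (mpoly_ring n)"
  shows "v (I +>\<^bsub>mpoly_ring n\<^esub> p) = S +>\<^bsub>type_ring\<^esub> eval_mpoly y p"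
proof -
  let ?cl = "\<lambda>p. I +>\<^bsub>mpoly_ring n\<^esub> p"
  have hom: "v \<in> Ring.ring_hom (mpoly_ring n Quot I) (type_ring Quot S)"
    and v_const: "v (?cl (mpoly_const a)) = S +>\<^bsub>type_ring\<^esub> a" for a
    using v by (simp_all add: alg_hom_def)
  have cl: "?cl p \<in> carrier (mpoly_ring n Quot I)" if "p \<in> carrier (mpoly_ring n)" for p
    using that by (auto simp: FactRing_def A_RCOSETS_def' a_r_coset_def')
  have v_mult: "v (?cl (p * q)) = v (?cl p) \<otimes>\<^bsub>type_ring Quot S\<^esub> v (?cl q)"
    if "p \<in> carrier (mpoly_ring n)" "q \<in> carrier (mpoly_ring n)" for p q
    using ring_hom_mult[OF hom cl[OF that(1)] cl[OF that(2)]] ideal.rcoset_mult_add[OF I that]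
    by (simp add: FactRing_def[of "mpoly_ring n"])
  have v_add: "v (?cl (p + q)) = v (?cl p) \<oplus>\<^bsub>type_ring Quot S\<^esub> v (?cl q)"
    if "p \<in> carrier (mpoly_ring n)" "q \<in> carrier (mpoly_ring n)" for p q
    using ring_hom_add[OF hom cl[OF that(1)] cl[OF that(2)]] ideal.a_rcos_sum[OF I that]
    by (simp add: FactRing_def[of "mpoly_ring n"])
  show ?thesis
    using p
  proof (induction rule: mpoly_ring_induct)
    case (const a)
    show ?case by (simp add: v_const)
  next
    case (var_mult i t a)
    then show ?case
      by (simp add: v_mult mpoly_ring_var y coset_mult[OF S] eval_mpoly_mult)
  next
    case (add p q)
    then show ?case
      by (simp add: v_add coset_add[OF S] eval_mpoly_add)
  qed
qed

text \<open>Evaluation at \<open>y\<close> is onto \<open>A\<close>, so the values of \<open>H\<close> already form an ideal, and its image modulo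
  \<open>\<mm>\<^sup>N\<close> contains the ideal generated by \<open>v(H)\<close>.\<close>

lemma values_fill_pw_if_genideal:
  assumes H: "ideal H (mpoly_ring n)" and N: "\<rho> < N"
    and v: "\<And>h. h \<in> H \<Longrightarrow> v h = pw N +>\<^bsub>type_ring\<^esub> eval_mpoly y h"
    and gen: "(\<lambda>a. pw N +>\<^bsub>type_ring\<^esub> a) ` pw \<rho> \<subseteq> genideal (type_ring Quot pw N) (v ` H)"
  shows "values_fill_pw H \<rho> y"
proof -
  have "ideal (eval_mpoly y ` H) type_ring"
    unfolding ideal_type_ring_iff
  proof (intro conjI ballI allI)
    show "0 \<in> eval_mpoly y ` H"
      using additive_subgroup.zero_closed[OF ideal.axioms(1)[OF H]] by (intro image_eqI[of _ _ 0]) auto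
  next
    fix x x' assume "x \<in> eval_mpoly y ` H" "x' \<in> eval_mpoly y ` H"
    then obtain h h' where h: "h \<in> H" "h' \<in> H" "x = eval_mpoly y h" "x' = eval_mpoly y h'" by blast
    then show "x + x' \<in> eval_mpoly y ` H"
      using additive_subgroup.a_closed[OF ideal.axioms(1)[OF H] h(1,2)]
      by (intro image_eqI[of _ _ "h + h'"]) (auto simp: eval_mpoly_add)
  next
    fix a x assume "x \<in> eval_mpoly y ` H"
    then obtain h where h: "h \<in> H" "x = eval_mpoly y h" by blast
    then show "a * x \<in> eval_mpoly y ` H"
      using ideal.I_l_closed[OF H h(1) mpoly_ring_const[of a]]
      by (intro image_eqI[of _ _ "mpoly_const a * h"]) (auto simp: eval_mpoly_mult)
  qed
  then have ideal: "ideal ((\<lambda>a. pw N +>\<^bsub>type_ring\<^esub> a) ` eval_mpoly y ` H) (type_ring Quot pw N)"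
    by (rule ring.ring_ideal_imp_quot_ideal[OF type_ring_ring ideal_pw])
  have "genideal (type_ring Quot pw N) (v ` H) \<subseteq> (\<lambda>a. pw N +>\<^bsub>type_ring\<^esub> a) ` eval_mpoly y ` H"
    using v by (intro ring.genideal_minimal[OF ideal.quotient_is_ring[OF ideal_pw] ideal]) auto
  with gen have sub: "(\<lambda>a. pw N +>\<^bsub>type_ring\<^esub> a) ` pw \<rho> \<subseteq> (\<lambda>a. pw N +>\<^bsub>type_ring\<^esub> a) ` eval_mpoly y ` H"
    by (rule order_trans)
  show ?thesis
    unfolding values_fill_pw_def
  proof
    fix a assume "a \<in> pw \<rho>"
    with sub obtain h where h: "h \<in> H" "pw N +>\<^bsub>type_ring\<^esub> a = pw N +>\<^bsub>type_ring\<^esub> eval_mpoly y h"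
      by blast
    then have "a - eval_mpoly y h \<in> pw N" by (simp add: coset_eq_iff[OF ideal_pw])
    then have "a - eval_mpoly y h \<in> pw (\<rho> + 1)" by (rule pw_antimonoD) (use N in simp)
    with h(1) show "\<exists>h\<in>H. a - eval_mpoly y h \<in> pw (\<rho> + 1)" by blast
  qed
qed

end

theorem theorem14:
  fixes A :: "'a::comm_ring_1 ring" and \<mm> :: "'a set"
    and n c \<rho> e N r :: nat
    and P :: "'a mpoly ring" and I :: "'a mpoly set" and B :: "'a mpoly set ring"
    and Q :: "'a set \<Rightarrow> 'a set"
    and v :: "'a mpoly set \<Rightarrow> 'a set"
    and f :: "nat \<Rightarrow> 'a mpoly"
  assumes A: "A = ring_of_type_algebra"
    and noetherian: "noetherian_ring A"
    and local: "local_ring A \<mm>"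
    and dim: "krull_dim A = 1"
    and P: "P = mpoly_ring n"
    and I: "ideal I P"
    and B: "B = P Quot I"
    and Q: "reduced_primary_decomposition A {\<zero>\<^bsub>A\<^esub>} (Ass A) Q"
    and e: "\<forall>p\<in>Ass A. ideal_power A p e \<subseteq> Q p"
    and N: "N = (e + 1) * (\<rho> + 1) + c"
    and v: "v \<in> alg_hom A B (\<lambda>a. I +>\<^bsub>P\<^esub> mpoly_const a)
                  (A Quot ideal_power A \<mm> N) (\<lambda>a. ideal_power A \<mm> N +>\<^bsub>A\<^esub> a)"
    and r: "r \<le> n"
    and f: "\<forall>i<r. f i \<in> I"
    and smooth: "(\<lambda>a. ideal_power A \<mm> N +>\<^bsub>A\<^esub> a) ` ideal_power A \<mm> \<rho> \<subseteq>
      genideal (A Quot ideal_power A \<mm> N)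
        (v ` (\<lambda>g. I +>\<^bsub>P\<^esub> g) `
          ideal_prod P (ideal_quotient P (genideal P (f ` {..<r})) I) (jacobian_ideal n r f))"
  shows "\<exists>v' \<in> alg_hom A B (\<lambda>a. I +>\<^bsub>P\<^esub> mpoly_const a)
                  (completion A \<mm>) (completion_map A \<mm>).
    \<forall>i<n.
      genideal (completion A \<mm>) (completion_map A \<mm> ` ideal_power A \<mm> c)
          +>\<^bsub>completion A \<mm>\<^esub> v' (I +>\<^bsub>P\<^esub> mpoly_var i) =
      induced_map (completion A \<mm>)
        (genideal (completion A \<mm>) (completion_map A \<mm> ` ideal_power A \<mm> c))
        (completion_map A \<mm>) (v (I +>\<^bsub>P\<^esub> mpoly_var i))"
proof -
  have max: "maximalideal \<mm> (type_ring :: 'a ring)"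
    using local by (simp add: A local_ring_def)
  interpret ideal_adic \<mm>
    by (rule ideal_adic.intro[OF maximalideal.axioms(1)[OF max]])
  interpret PR: cring "mpoly_ring n :: 'a mpoly ring" by (rule mpoly_ring_cring)
  note noeth = noetherian[unfolded A]
  have I': "ideal I (mpoly_ring n)" using I by (simp add: P)
  have I_sub: "I \<subseteq> carrier (mpoly_ring n)"
    using I' by (meson additive_subgroup.a_subset ideal.axioms(1))
  have Q': "reduced_primary_decomposition (type_ring :: 'a ring) {0} (Ass type_ring) Q"
    using Q by (simp add: A)

  \<comment> \<open>Since \<open>\<pp>\<^sup>0 = A\<close> lies in no primary ideal, \<open>e \<ge> 1\<close>. This makes \<open>N\<close> large enough for Newton's method.\<close>
  have e_pos: "e \<noteq> 0"
  proof
    assume "e = 0"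
    have "Ass (type_ring :: 'a ring) \<noteq> {}"
    proof
      assume "Ass (type_ring :: 'a ring) = {}"
      then have "(UNIV :: 'a set) = {0}" using Q' by (simp add: reduced_primary_decomposition_def)
      then have "x \<in> \<mm>" for x
        using ideal_0[OF ideal_m] by (metis UNIV_I singletonD)
      then have "\<mm> = UNIV" by blast
      then show False using maximalideal.I_notcarr[OF max] by simp
    qed
    then obtain p where p: "p \<in> Ass (type_ring :: 'a ring)" by blast
    have "ideal_power type_ring p 0 \<subseteq> Q p" using e p \<open>e = 0\<close> by (simp add: A)
    then have "Q p = UNIV" by (simp add: ideals_set_def top_unique)
    then show False
      using Q' p by (simp add: reduced_primary_decomposition_def primary_ideal_def)
  qed
  then have "\<rho> \<le> e * \<rho>" by simp
  moreover have "N = e * \<rho> + e + \<rho> + 1 + c" by (simp add: N)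
  ultimately have N_bounds: "2 * \<rho> + 1 \<le> N" "e + \<rho> \<le> N" "c \<le> N - \<rho>" "c \<le> N" "\<rho> < N"
    using e_pos by linarith+

  have colon: "\<exists>K. \<forall>a\<in>pw e. (\<forall>b\<in>pw \<rho>. b * a \<in> pw K) \<longrightarrow> a \<in> pw M" for M
  proof (rule pw_colon_pw_subset[OF noeth local[unfolded A] _ _ Q'])
    show "krull_dim (type_ring :: 'a ring) \<le> 1" using dim by (simp add: A)
    show "primeideal p type_ring" if "p \<in> Ass type_ring" for p :: "'a set"
      using that by (simp add: Ass_def)
    show "pw e \<subseteq> Q \<mm>" if "\<mm> \<in> Ass type_ring"
      using that e by (simp add: A pw_def)
  qed

  define F where "F = genideal (mpoly_ring n) (f ` {..<r})"
  define H where "H = ideal_prod (mpoly_ring n) (ideal_quotient (mpoly_ring n) F I) (jacobian_ideal n r f)"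
  have f_carrier: "f i \<in> carrier (mpoly_ring n)" if "i < r" for i
    using f I_sub that by blast
  have quot_ideal: "ideal (ideal_quotient (mpoly_ring n) F I) (mpoly_ring n)"
    unfolding F_def using f_carrier by (intro PR.ideal_quotient_ideal PR.genideal_ideal I_sub) auto
  have jac_ideal: "ideal (jacobian_ideal n r f) (mpoly_ring n)"
    unfolding jacobian_ideal_def using f_carrier
    by (intro PR.genideal_ideal) (auto intro: jacobian_minor_carrier)
  have H_ideal: "ideal H (mpoly_ring n)"
    unfolding H_def by (rule PR.ideal_prod_is_ideal[OF quot_ideal jac_ideal])
  have H_inter: "H \<subseteq> ideal_quotient (mpoly_ring n) F I \<inter> jacobian_ideal n r f"
    unfolding H_def by (rule PR.ideal_prod_inter[OF quot_ideal jac_ideal])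
  have H_sub: "H \<subseteq> carrier (mpoly_ring n)"
    using H_ideal by (meson additive_subgroup.a_subset ideal.axioms(1))

  note v' = v[unfolded A B P, folded pw_def]
  have v_hom: "v \<in> Ring.ring_hom (mpoly_ring n Quot I) (type_ring Quot pw N)"
    using v' by (simp add: alg_hom_def)
  have "\<forall>i. \<exists>a. i < n \<longrightarrow> v (I +>\<^bsub>mpoly_ring n\<^esub> mpoly_var i) = pw N +>\<^bsub>type_ring\<^esub> a"
  proof
    fix i
    have "v (I +>\<^bsub>mpoly_ring n\<^esub> mpoly_var i) \<in> range (\<lambda>a. pw N +>\<^bsub>type_ring\<^esub> a)" if "i < n"
      unfolding carrier_type_Quot[OF ideal_pw, symmetric]
      using mpoly_ring_var[OF that]
      by (intro ring_hom_closed[OF v_hom]) (auto simp: FactRing_def A_RCOSETS_def' a_r_coset_def')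
    then show "\<exists>a. i < n \<longrightarrow> v (I +>\<^bsub>mpoly_ring n\<^esub> mpoly_var i) = pw N +>\<^bsub>type_ring\<^esub> a" by blast
  qed
  then obtain y where y: "\<And>i. i < n \<Longrightarrow> v (I +>\<^bsub>mpoly_ring n\<^esub> mpoly_var i) = pw N +>\<^bsub>type_ring\<^esub> y i"
    by metis
  have v_eval: "v (I +>\<^bsub>mpoly_ring n\<^esub> p) = pw N +>\<^bsub>type_ring\<^esub> eval_mpoly y p"
    if "p \<in> carrier (mpoly_ring n)" for p
    using I' ideal_pw v' y that by (rule alg_hom_eq_eval)
  have y_zero: "eval_mpoly y g \<in> pw N" if g: "g \<in> I" for g
  proof -
    have "I +>\<^bsub>mpoly_ring n\<^esub> g = I +>\<^bsub>mpoly_ring n\<^esub> 0"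
      using PR.a_rcos_zero[OF I' g] PR.a_rcos_zero[OF I', of 0]
        additive_subgroup.zero_closed[OF ideal.axioms(1)[OF I']] by simp
    then have "pw N +>\<^bsub>type_ring\<^esub> eval_mpoly y g = pw N +>\<^bsub>type_ring\<^esub> eval_mpoly y 0"
      using v_eval[of g] v_eval[of 0] g I_sub mpoly_ring_0 by auto
    then show ?thesis by (simp add: coset_eq_iff[OF ideal_pw])
  qed
  have fill: "values_fill_pw H \<rho> y"
  proof (rule values_fill_pw_if_genideal[OF H_ideal N_bounds(5)])
    show "(\<lambda>g. v (I +>\<^bsub>mpoly_ring n\<^esub> g)) h = pw N +>\<^bsub>type_ring\<^esub> eval_mpoly y h" if "h \<in> H" for h
      using v_eval that H_sub by blast
    show "(\<lambda>a. pw N +>\<^bsub>type_ring\<^esub> a) ` pw \<rho> \<subseteq>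
        genideal (type_ring Quot pw N) ((\<lambda>g. v (I +>\<^bsub>mpoly_ring n\<^esub> g)) ` H)"
      using smooth by (simp only: A P H_def F_def pw_def image_image)
  qed

  have HI: "h * g \<in> genideal (mpoly_ring n) (f ` {..<r})" if "h \<in> H" "g \<in> I" for h g
    using that H_inter by (auto simp: ideal_quotient_def F_def)
  obtain Y where Y_Suc: "\<And>l. \<forall>k. Y (Suc k) l - Y k l \<in> pw k"
    and Y_y: "\<And>k l. Y k l - y l \<in> pw (N - \<rho>)"
    and Y_zero: "\<And>k g. g \<in> I \<Longrightarrow> eval_mpoly (Y k) g \<in> pw k"
    using newton_limit[of H n r f I \<rho> y N e, OF H_ideal _ HI I_sub _ fill y_zero N_bounds(1,2) colon]
      H_inter f by blast
  have Y: "coherent (\<lambda>k. Y k l)" for l using Y_Suc by (simp add: coherent_def)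

  show ?thesis
    unfolding A B P
  proof (intro bexI[of _ "limit_hom Y"] allI impI)
    show "limit_hom Y \<in> alg_hom type_ring (mpoly_ring n Quot I)
        (\<lambda>a. I +>\<^bsub>mpoly_ring n\<^esub> mpoly_const a) (completion type_ring \<mm>) (completion_map type_ring \<mm>)"
      using limit_hom_in_ring_hom[OF I' Y Y_zero]
      by (simp add: alg_hom_def limit_hom_coset[OF I' Y Y_zero] completion_map_eq)
  next
    fix i assume i: "i < n"
    have "Y k i - y i \<in> pw c" for k
      using Y_y N_bounds(3) by (rule pw_antimonoD)
    from coset_adic_limit_eq[OF noeth N_bounds(4) Y this]
    show "genideal (completion type_ring \<mm>) (completion_map type_ring \<mm> ` ideal_power type_ring \<mm> c)
          +>\<^bsub>completion type_ring \<mm>\<^esub> limit_hom Y (I +>\<^bsub>mpoly_ring n\<^esub> mpoly_var i) =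
      induced_map (completion type_ring \<mm>)
        (genideal (completion type_ring \<mm>) (completion_map type_ring \<mm> ` ideal_power type_ring \<mm> c))
        (completion_map type_ring \<mm>) (v (I +>\<^bsub>mpoly_ring n\<^esub> mpoly_var i))"
      by (simp add: limit_hom_coset[OF I' Y Y_zero] y[OF i] pw_def)
  qed
qed

end
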